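(* Let $N\ge 3$ and $d\ge 2$. Let $\rho=\rho(r)\,dr\,d\theta$ be a radially symmetric probability measure on $\mathbb{R}^d$, and let $\mu=\rho(r)\,dr$ on $[0,\infty)$. Assume that for some minimizer $\gamma$ of $\int h\,d\gamma$ among probability measures on $[0,\infty)^N$ with all $N$ one-dimensional marginals equal to $\mu$, there is at least one point $\vec r=(r_1,\dots,r_N)\in\operatorname{spt}(\gamma)$ for which the following two conditions hold: 1. The radii $r_1,\dots,r_N$ are distinct. 2. There exist $x_1(\vec r),\dots,x_N(\vec r)$ attaining the infimum defining $h(\vec r)$ that span $\mathbb{R}^d$. Then there is more than one symmetric $\rho_N\in\Pi(\rho)$ with $C_N(\rho_N)=E_N[\rho]$.
   Context: For a probability measure $\rho$ on $\mathbb{R}^d$, $\Pi(\rho)$ is the set of probability measures on $(\mathbb{R}^{d})^N$ all of whose $N$ marginals on $\mathbb{R}^d$ equal $\rho$. For $\rho_N\in\Pi(\rho)$, $$C_N(\rho_N)=\int_{\mathbb{R}^{dN}}\sum_{i\ne j}\frac{1}{|x_i-x_j|}\,d\rho_N\in[0,\infty],\qquad E_N[\rho]=\inf_{\rho_N\in\Pi(\rho)}C_N(\rho_N),$$ with $1/0=+\infty$. A measure on $(\mathbb{R}^d)^N$ is symmetric if it is invariant under all permutations of the arguments $(x_1,\dots,x_N)$. Polar coordinates identify $\mathbb{R}^d$ with $[0,\infty)\times\mathbb{S}^{d-1}$, $d\theta$ is the uniform probability measure on $\mathbb{S}^{d-1}$, and radial symmetry of $\rho=\rho(r,\theta)\,dr\,d\theta$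 means that $\rho(r,\theta)=\rho(r)$ is independent of $\theta$. The reduced cost is $$h(r_1,\dots,r_N)=\inf_{|x_1|=r_1,\dots,|x_N|=r_N}\ \sum_{i\ne j}\frac1{|x_i-x_j|},\qquad x_i\in\mathbb{R}^d .$$ $\operatorname{spt}$ denotes the support of a measure. *)

theory Defs
  imports "HOL-Probability.Probability"
begin

text \<open>
  A configuration of \<open>N\<close> points of a space \<open>'a\<close> is a vector \<open>x :: 'a ^ 'n\<close> with \<open>N = CARD('n)\<close>;
  its Borel sets are those of the product topology.
\<close>

definition couplings :: "'a::topological_space measure \<Rightarrow> ('a ^ 'n) measure set" where
  "couplings \<mu> = {\<gamma>. sets \<gamma> = sets borel \<and> prob_space \<gamma> \<and> (\<forall>i. distr \<gamma> borel (\<lambda>x. x $ i) = \<mu>)}"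

definition symmetric_measure :: "('a::topological_space ^ 'n) measure \<Rightarrow> bool" where
  "symmetric_measure \<gamma> \<longleftrightarrow>
     (\<forall>\<pi>. \<pi> permutes UNIV \<longrightarrow> distr \<gamma> borel (\<lambda>x. \<chi> i. x $ \<pi> i) = \<gamma>)"

definition spt :: "'a::topological_space measure \<Rightarrow> 'a set" where
  "spt M = {x. \<forall>U. open U \<and> x \<in> U \<longrightarrow> 0 < emeasure M U}"

text \<open>The sum is over ordered pairs; in \<^typ>\<open>ennreal\<close> we have \<open>1 / 0 = \<top>\<close>.\<close>

definition coulomb :: "('a::real_normed_vector) ^ 'n \<Rightarrow> ennreal" where
  "coulomb x = (\<Sum>i\<in>UNIV. \<Sum>j\<in>UNIV - {i}. 1 / ennreal (norm (x $ i - x $ j)))"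

definition total_cost :: "(('a::real_normed_vector) ^ 'n) measure \<Rightarrow> ennreal" where
  "total_cost \<gamma> = (\<integral>\<^sup>+ x. coulomb x \<partial>\<gamma>)"

definition min_cost :: "'n::finite itself \<Rightarrow> 'a::real_normed_vector measure \<Rightarrow> ennreal" where
  "min_cost _ \<rho> = (INF \<gamma> \<in> (couplings \<rho> :: ('a ^ 'n) measure set). total_cost \<gamma>)"

text \<open>
  Radii are real numbers: the half-line \<open>[0, \<infinity>)\<close> is not a separate type. The value of the
  reduced cost at a vector with a negative entry is \<open>\<top>\<close> (infimum of the empty set), but
  couplings of a measure concentrated on \<open>[0, \<infinity>)\<close> do not charge such vectors.
\<close>

definition configurations :: "real ^ 'n \<Rightarrow> (('a::real_normed_vector) ^ 'n) set" where
  "configurations r = {x. \<forall>i. norm (x $ i) = r $ i}"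

definition reduced_cost :: "'a::real_normed_vector itself \<Rightarrow> real ^ 'n \<Rightarrow> ennreal" where
  "reduced_cost _ r = (INF x \<in> (configurations r :: ('a ^ 'n) set). coulomb x)"

definition reduced_minimizer ::
    "'a::real_normed_vector itself \<Rightarrow> real measure \<Rightarrow> (real ^ 'n) measure \<Rightarrow> bool" where
  "reduced_minimizer T \<mu> \<gamma> \<longleftrightarrow> \<gamma> \<in> couplings \<mu> \<and>
     (\<forall>\<gamma>' \<in> (couplings \<mu> :: (real ^ 'n) measure set).
        (\<integral>\<^sup>+ r. reduced_cost T r \<partial>\<gamma>) \<le> (\<integral>\<^sup>+ r. reduced_cost T r \<partial>\<gamma>'))"

text \<open>
  The uniform probability measure on the unit sphere, as the law of the direction \<open>x / \<bar>x\<bar>\<close> of a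
  uniformly distributed point \<open>x\<close> of the unit ball. The lemmas below show that this is a
  probability measure, concentrated on the sphere and invariant under all rotations.
\<close>

definition uniform_sphere :: "'a::euclidean_space measure" where
  "uniform_sphere = distr (uniform_measure lborel (ball 0 1)) borel sgn"

lemma sets_uniform_sphere [simp, measurable_cong]: "sets (uniform_sphere :: 'a::euclidean_space measure) = sets borel"
  by (simp add: uniform_sphere_def)

lemma sgn_borel_measurable [measurable]: "(sgn :: 'a::euclidean_space \<Rightarrow> 'a) \<in> borel_measurable borel"
proof -
  have "(\<lambda>x :: 'a. x /\<^sub>R norm x) \<in> borel_measurable borel"
    by measurable
  then show ?thesis
    by (simp add: sgn_div_norm[abs_def])
qed

lemma emeasure_unit_ball:
  "emeasure lborel (ball (0 :: 'a::euclidean_space) 1) \<noteq> 0"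
  "emeasure lborel (ball (0 :: 'a::euclidean_space) 1) \<noteq> \<infinity>"
  using content_ball_pos[of 1 "0 :: 'a"] emeasure_lborel_ball_finite[of "0 :: 'a" 1]
  by (auto simp: measure_def)

lemma prob_space_uniform_sphere: "prob_space (uniform_sphere :: 'a::euclidean_space measure)"
  unfolding uniform_sphere_def
  by (rule prob_space.prob_space_distr[OF prob_space_uniform_measure])
     (use emeasure_unit_ball in auto)

lemma AE_uniform_sphere: "AE x in (uniform_sphere :: 'a::euclidean_space measure). norm x = 1"
proof -
  have "AE x in lborel. x \<in> ball (0 :: 'a) 1 \<longrightarrow> norm (sgn x) = 1"
    using AE_lborel_singleton[of "0 :: 'a"] by eventually_elim (simp add: norm_sgn)
  then have "AE x in uniform_measure lborel (ball (0 :: 'a) 1). norm (sgn x) = 1"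
    by (intro AE_uniform_measureI) auto
  then show ?thesis
    unfolding uniform_sphere_def by (subst AE_distr_iff) auto
qed

lemma nn_integral_lborel_translate:
  fixes F :: "'a::euclidean_space \<Rightarrow> ennreal"
  assumes "F \<in> borel_measurable borel"
  shows "(\<integral>\<^sup>+ x. F (c + x) \<partial>lborel) = (\<integral>\<^sup>+ x. F x \<partial>lborel)"
proof -
  have "(\<integral>\<^sup>+ x. F x \<partial>distr lborel borel ((+) c)) = (\<integral>\<^sup>+ x. F (c + x) \<partial>lborel)"
    using assms by (subst nn_integral_distr) auto
  then show ?thesis
    by (simp add: lborel_distr_plus)
qed

lemma borel_measurable_orthogonal_transformation:
  fixes T :: "'a::euclidean_space \<Rightarrow> 'a"
  assumes "orthogonal_transformation T"
  shows "T \<in> borel_measurable borel"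
  using assms by (intro borel_measurable_continuous_onI linear_continuous_on)
    (simp add: orthogonal_transformation_linear linear_conv_bounded_linear[symmetric])

text \<open>The image of Lebesgue measure is translation invariant and agrees with it on the unit ball.\<close>

lemma distr_orthogonal_lborel:
  fixes T :: "'a::euclidean_space \<Rightarrow> 'a"
  assumes T: "orthogonal_transformation T"
  shows "distr lborel borel T = lborel"
proof (rule measure_eqI)
  show "sets (distr lborel borel T) = sets (lborel :: 'a measure)"
    by simp
  fix A assume "A \<in> sets (distr lborel borel T)"
  then have A [measurable]: "A \<in> sets borel"
    by simp
  note [measurable] = borel_measurable_orthogonal_transformation[OF T]
  obtain S where S: "\<And>x. T (S x) = x"
    using orthogonal_transformation_surj[OF T] by (metis surjD)
  have add: "T (x + y) = T x + T y" and diff: "T (x - y) = T x - T y" for x y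
    using orthogonal_transformation_linear[OF T] by (simp_all add: linear_add linear_diff)
  define f g :: "'a \<Rightarrow> ennreal" where "f = indicator (ball 0 1)" and "g = indicator A"
  have [measurable]: "f \<in> borel_measurable borel" "g \<in> borel_measurable borel"
    unfolding f_def g_def by (auto intro!: borel_measurable_indicator)
  have ball: "(\<integral>\<^sup>+ y. f (x - T y) \<partial>lborel) = emeasure lborel (ball (0 :: 'a) 1)" for x
  proof -
    have "f (x - T y) = f (- S x + y)" for y
    proof -
      have "norm (x - T y) = norm (T (S x - y))"
        by (simp add: diff S)
      also have "\<dots> = norm (- S x + y)"
        by (simp add: orthogonal_transformation_norm[OF T] norm_minus_commute)
      finally show ?thesis
        by (simp add: f_def indicator_def)
    qed
    then have "(\<integral>\<^sup>+ y. f (x - T y) \<partial>lborel) = (\<integral>\<^sup>+ y. f y \<partial>lborel)"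
      by (simp only:) (rule nn_integral_lborel_translate, measurable)
    then show ?thesis
      by (simp add: f_def)
  qed
  have trans: "(\<integral>\<^sup>+ y. g (x + T y) \<partial>lborel) = (\<integral>\<^sup>+ y. g (T y) \<partial>lborel)" for x
  proof -
    have "(\<integral>\<^sup>+ y. g (T (S x + y)) \<partial>lborel) = (\<integral>\<^sup>+ y. g (T y) \<partial>lborel)"
      by (rule nn_integral_lborel_translate) measurable
    then show ?thesis
      by (simp add: add S)
  qed
  have "emeasure lborel (ball (0 :: 'a) 1) * (\<integral>\<^sup>+ y. g (T y) \<partial>lborel)
      = (\<integral>\<^sup>+ x. f x * (\<integral>\<^sup>+ y. g (T y) \<partial>lborel) \<partial>lborel)"
    by (simp add: nn_integral_multc) (simp add: f_def)
  also have "\<dots> = (\<integral>\<^sup>+ x. f x * (\<integral>\<^sup>+ y. g (x + T y) \<partial>lborel) \<partial>lborel)"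
    by (simp only: trans)
  also have "\<dots> = (\<integral>\<^sup>+ x. (\<integral>\<^sup>+ y. f x * g (x + T y) \<partial>lborel) \<partial>lborel)"
    by (simp add: nn_integral_cmult)
  also have "\<dots> = (\<integral>\<^sup>+ y. (\<integral>\<^sup>+ x. f x * g (x + T y) \<partial>lborel) \<partial>lborel)"
    by (rule lborel_pair.Fubini') measurable
  also have "\<dots> = (\<integral>\<^sup>+ y. (\<integral>\<^sup>+ x. f (x - T y) * g x \<partial>lborel) \<partial>lborel)"
  proof -
    have "(\<integral>\<^sup>+ x. f x * g (x + T y) \<partial>lborel) = (\<integral>\<^sup>+ x. f (x - T y) * g x \<partial>lborel)" for y
      using nn_integral_lborel_translate[of "\<lambda>x. f (x - T y) * g x" "T y"]
      by (simp add: add.commute)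
    then show ?thesis
      by simp
  qed
  also have "\<dots> = (\<integral>\<^sup>+ x. (\<integral>\<^sup>+ y. f (x - T y) * g x \<partial>lborel) \<partial>lborel)"
    by (rule lborel_pair.Fubini') measurable
  also have "\<dots> = emeasure lborel (ball (0 :: 'a) 1) * (\<integral>\<^sup>+ x. g x \<partial>lborel)"
    by (simp add: nn_integral_multc nn_integral_cmult ball)
  finally have "(\<integral>\<^sup>+ y. g (T y) \<partial>lborel) = (\<integral>\<^sup>+ x. g x \<partial>lborel)"
    using emeasure_unit_ball[where 'a = 'a] by (simp add: ennreal_mult_cancel_left)
  moreover have "(\<integral>\<^sup>+ y. g (T y) \<partial>lborel) = (\<integral>\<^sup>+ y. g y \<partial>distr lborel borel T)"
    by (subst nn_integral_distr) auto
  ultimately show "emeasure (distr lborel borel T) A = emeasure lborel A"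
    by (simp add: g_def)
qed

lemma distr_orthogonal_uniform_sphere:
  fixes T :: "'a::euclidean_space \<Rightarrow> 'a"
  assumes T: "orthogonal_transformation T"
  shows "distr uniform_sphere borel T = uniform_sphere"
proof -
  let ?B = "ball (0 :: 'a) 1"
  note [measurable] = borel_measurable_orthogonal_transformation[OF T]
  have [simp]: "norm (T x) = norm x" for x
    using T by (rule orthogonal_transformation_norm)
  have sgnT: "T (sgn x) = sgn (T x)" for x
    using T by (simp add: sgn_div_norm linear_scale orthogonal_transformation_linear)
  have [measurable]: "(\<lambda>x. indicator ?B x / emeasure lborel ?B) \<in> borel_measurable lborel"
    by (intro borel_measurable_divide_ennreal borel_measurable_indicator) auto
  have "distr (density lborel (\<lambda>x. indicator ?B (T x) / emeasure lborel ?B)) borel T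
      = density (distr lborel borel T) (\<lambda>x. indicator ?B x / emeasure lborel ?B)"
    by (subst density_distr) auto
  then have "distr (uniform_measure lborel ?B) borel T = uniform_measure lborel ?B"
    unfolding uniform_measure_def by (simp add: distr_orthogonal_lborel[OF T] indicator_def)
  then have "distr (distr (uniform_measure lborel ?B) borel T) borel sgn = uniform_sphere"
    by (simp add: uniform_sphere_def)
  then show ?thesis
    unfolding uniform_sphere_def by (simp add: distr_distr comp_def sgnT)
qed

definition radial_part :: "(real \<Rightarrow> real) \<Rightarrow> real measure" where
  "radial_part f = density lborel (\<lambda>r. ennreal (f r) * indicator {0..} r)"

text \<open>The measure \<open>f(r) dr d\<theta>\<close>: image of a product measure under \<open>(r, \<theta>) \<mapsto> r \<theta>\<close>.\<close>

definition radial_measure :: "(real \<Rightarrow> real) \<Rightarrow> 'a::euclidean_space measure" where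
  "radial_measure f =
     distr (radial_part f \<Otimes>\<^sub>M (uniform_sphere :: 'a measure)) borel (\<lambda>(r, \<theta>). r *\<^sub>R \<theta>)"

end

theory Submission
  imports Defs
begin

text \<open>
  Choose measurably, for each vector of radii, a minimizing configuration \<open>s(r)\<close>, and rotate \<open>s(r)\<close>,
  with \<open>r\<close> distributed according to \<open>\<gamma>\<close>, by an independent random element of \<open>SO(d)\<close>. Every one-point
  marginal of the result is \<open>\<rho>\<close> and its cost is \<open>\<integral> h d\<gamma>\<close>, which is a lower bound for the cost of any
  coupling; so it is optimal, and so is its symmetrization. Replacing \<open>s(r)\<close> by a mirror image yields
  another optimal coupling, which is different as soon as \<open>s(r)\<close> spans the space for a set of \<open>r\<close>
  of positive measure: rotations preserve the orientation of a spanning configuration.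

  Spanning is only assumed for one minimizer at one point of the support, and it must be extended
  to all minimizers at all nearby radii. The cost is a strictly convex function of the Gram matrix. If a
  minimizer does not span the space, perturbing it in an unused direction shows that its Gram matrix
  is optimal among all Gram matrices of any rank, hence unique; so no other minimizer at the same radii
  spans. Thus one spanning minimizer forces all minimizers at these radii to span, and compactness
  extends this to a neighbourhood.
\<close>

subsection \<open>Measurable selection\<close>

text \<open>Distinct radii enter twice. They keep the points of a configuration apart, so that the
  cost is finite and smooth there; and they label the points. The second role answers to
  symmetrization: unlike rotations, permutations of the points may reverse the sign of a
  determinant, so the orientation that separates the two couplings has to be computed from points
  recognized by their radii. A further obstacle is cancellation. If the selected minimizers had
  orientations of both signs, the law of the orientation could be symmetric about 0 and the mirror
  image need not be a different measure. The selection is therefore reflected wherever its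
  orientation is negative. Then the orientation is nonnegative under one coupling and nonpositive
  under the other, and equality of the two would make it vanish almost surely. A random rotation
  arises by Gram-Schmidt from a uniformly distributed matrix: equivariance of Gram-Schmidt under
  orthogonal maps hands the rotation invariance of Lebesgue measure on to it.\<close>

lemma measurable_selection_coordinates:
  fixes A :: "'m \<Rightarrow> 'b::euclidean_space set"
  assumes B: "finite B" "B \<subseteq> Basis"
    and compact: "\<And>w. w \<in> space M \<Longrightarrow> compact (A w) \<and> A w \<noteq> {}"
    and hit: "\<And>C. closed C \<Longrightarrow> {w \<in> space M. A w \<inter> C \<noteq> {}} \<in> sets M"
  shows "\<exists>A'. (\<forall>w \<in> space M. compact (A' w) \<and> A' w \<noteq> {} \<and> A' w \<subseteq> A w \<and>
             (\<forall>x \<in> A' w. \<forall>y \<in> A' w. \<forall>b \<in> B. x \<bullet> b = y \<bullet> b)) \<and>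
           (\<forall>C. closed C \<longrightarrow> {w \<in> space M. A' w \<inter> C \<noteq> {}} \<in> sets M)"
  using B
proof (induction B rule: finite_induct)
  case empty
  then show ?case
    using compact hit by (intro exI[of _ A]) auto
next
  case (insert b B)
  then have "\<exists>A'. (\<forall>w \<in> space M. compact (A' w) \<and> A' w \<noteq> {} \<and> A' w \<subseteq> A w \<and>
             (\<forall>x \<in> A' w. \<forall>y \<in> A' w. \<forall>b \<in> B. x \<bullet> b = y \<bullet> b)) \<and>
           (\<forall>C. closed C \<longrightarrow> {w \<in> space M. A' w \<inter> C \<noteq> {}} \<in> sets M)"
    by simp
  then obtain A' where *: "\<forall>w \<in> space M. compact (A' w) \<and> A' w \<noteq> {} \<and> A' w \<subseteq> A w \<and>
             (\<forall>x \<in> A' w. \<forall>y \<in> A' w. \<forall>b \<in> B. x \<bullet> b = y \<bullet> b)"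
    and "\<forall>C. closed C \<longrightarrow> {w \<in> space M. A' w \<inter> C \<noteq> {}} \<in> sets M"
    by (elim exE conjE)
  then have hit': "\<And>C. closed C \<Longrightarrow> {w \<in> space M. A' w \<inter> C \<noteq> {}} \<in> sets M"
    by blast
  have A': "compact (A' w) \<and> A' w \<noteq> {} \<and> A' w \<subseteq> A w" if "w \<in> space M" for w
    using * that by blast
  have eq: "x \<bullet> c = y \<bullet> c" if "w \<in> space M" "x \<in> A' w" "y \<in> A' w" "c \<in> B" for w x y c
    using * that by blast
  \<comment> \<open>Fixing one more coordinate: only the points with the least
    \<open>b\<close>-coordinate are kept, so that the induction produces a successive
    (lexicographic) minimum.\<close>
  define A'' where "A'' w = {x \<in> A' w. \<forall>y \<in> A' w. x \<bullet> b \<le> y \<bullet> b}" for w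
  have nonempty: "\<exists>x \<in> A' w. \<forall>y \<in> A' w. x \<bullet> b \<le> y \<bullet> b" if "w \<in> space M" for w
    using A'[OF that] by (intro continuous_attains_inf continuous_intros) auto
  have compact': "compact (A'' w)" if "w \<in> space M" for w
  proof -
    have "A'' w = A' w \<inter> (\<Inter>y\<in>A' w. {x. x \<bullet> b \<le> y \<bullet> b})"
      by (auto simp: A''_def)
    moreover have "closed (\<Inter>y\<in>A' w. {x. x \<bullet> b \<le> y \<bullet> b})"
      by (intro closed_INT ballI closed_Collect_le continuous_intros)
    ultimately show ?thesis
      using A'[OF that] by (simp add: compact_Int_closed)
  qed
  have hit'': "{w \<in> space M. A'' w \<inter> C \<noteq> {}} \<in> sets M" if "closed C" for C
  proof -
    let ?L = "\<lambda>q::rat. {x. x \<bullet> b \<le> of_rat q}"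
    have closed_L: "closed (?L q)" for q
      by (intro closed_Collect_le continuous_intros)
    \<comment> \<open>By compactness, \<open>C\<close> misses the minimizing face exactly when the
      minimum over \<open>A' w\<close> lies strictly below the minimum over
      \<open>A' w \<inter> C\<close>. A rational level between the two turns this into a countable
      union of differences of hitting sets.\<close>
    have "A'' w \<inter> C = {} \<longleftrightarrow> (\<exists>q. A' w \<inter> ?L q \<noteq> {} \<and> A' w \<inter> (C \<inter> ?L q) = {})"
      if w: "w \<in> space M" for w
    proof
      assume empty: "A'' w \<inter> C = {}"
      obtain x where x: "x \<in> A' w" "\<And>y. y \<in> A' w \<Longrightarrow> x \<bullet> b \<le> y \<bullet> b"
        using nonempty[OF w] by blast
      have "\<exists>t > x \<bullet> b. \<forall>y \<in> A' w \<inter> C. t \<le> y \<bullet> b"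
      proof (cases "A' w \<inter> C = {}")
        case True
        then show ?thesis
          by (auto intro: exI[of _ "x \<bullet> b + 1"])
      next
        case False
        have "\<exists>y \<in> A' w \<inter> C. \<forall>z \<in> A' w \<inter> C. y \<bullet> b \<le> z \<bullet> b"
          using A'[OF w] \<open>closed C\<close> False
          by (intro continuous_attains_inf continuous_intros compact_Int_closed) auto
        then obtain y where y: "y \<in> A' w \<inter> C" "\<And>z. z \<in> A' w \<inter> C \<Longrightarrow> y \<bullet> b \<le> z \<bullet> b"
          by blast
        have "x \<bullet> b < y \<bullet> b"
        proof (rule ccontr)
          assume "\<not> x \<bullet> b < y \<bullet> b"
          then have "y \<in> A'' w"
            using x(2) y(1) unfolding A''_def by fastforce
          then show False
            using y(1) empty by blast
        qed
        then show ?thesis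
          using y by blast
      qed
      then obtain t where t: "x \<bullet> b < t" "\<And>y. y \<in> A' w \<inter> C \<Longrightarrow> t \<le> y \<bullet> b"
        by blast
      obtain q where q: "x \<bullet> b < of_rat q" "of_rat q < t"
        using of_rat_dense[OF t(1)] by blast
      then show "\<exists>q. A' w \<inter> ?L q \<noteq> {} \<and> A' w \<inter> (C \<inter> ?L q) = {}"
      proof (intro exI[of _ q] conjI)
        show "A' w \<inter> ?L q \<noteq> {}"
          using x(1) q(1) by fastforce
        show "A' w \<inter> (C \<inter> ?L q) = {}"
          using t(2) q(2) by fastforce
      qed
    next
      assume "\<exists>q. A' w \<inter> ?L q \<noteq> {} \<and> A' w \<inter> (C \<inter> ?L q) = {}"
      then obtain q z where z: "z \<in> A' w" "z \<bullet> b \<le> of_rat q" and q: "A' w \<inter> (C \<inter> ?L q) = {}"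
        by blast
      have False if "x \<in> A'' w" "x \<in> C" for x
      proof -
        have "x \<bullet> b \<le> of_rat q"
          using that z unfolding A''_def by fastforce
        then show False
          using that q unfolding A''_def by blast
      qed
      then show "A'' w \<inter> C = {}"
        by blast
    qed
    then have "{w \<in> space M. \<not> A'' w \<inter> C = {}} = {w \<in> space M. \<not> (\<exists>q. A' w \<inter> ?L q \<noteq> {} \<and> A' w \<inter> (C \<inter> ?L q) = {})}"
      by (intro Collect_cong conj_cong refl) simp
    also have "\<dots> = space M -
      (\<Union>q. {w \<in> space M. A' w \<inter> ?L q \<noteq> {}} - {w \<in> space M. A' w \<inter> (C \<inter> ?L q) \<noteq> {}})"
      by blast
    also have "\<dots> \<in> sets M"
      by (intro sets.Diff sets.top sets.countable_UN) (auto intro!: sets.Diff hit' closed_L closed_Int \<open>closed C\<close>)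
    finally show ?thesis .
  qed
  have eq': "x \<bullet> c = y \<bullet> c" if "w \<in> space M" "x \<in> A'' w" "y \<in> A'' w" "c \<in> insert b B" for w x y c
  proof (cases "c = b")
    case True
    have "x \<bullet> b \<le> y \<bullet> b" "y \<bullet> b \<le> x \<bullet> b"
      using that by (simp_all add: A''_def)
    then show ?thesis
      using True by simp
  next
    case False
    then show ?thesis
      using that eq[of w x y c] by (simp add: A''_def)
  qed
  have nonempty': "A'' w \<noteq> {} \<and> A'' w \<subseteq> A w" if "w \<in> space M" for w
  proof -
    from nonempty[OF that] obtain x where "x \<in> A' w" "\<forall>y \<in> A' w. x \<bullet> b \<le> y \<bullet> b"
      by (elim bexE)
    then have "x \<in> A'' w"
      by (simp add: A''_def)
    moreover have "A'' w \<subseteq> A' w"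
      by (auto simp: A''_def)
    ultimately show ?thesis
      using A'[OF that] by (metis empty_iff order_trans)
  qed
  show ?case
    by (rule exI[of _ A'']) (intro conjI ballI allI impI compact' nonempty'[THEN conjunct1]
      nonempty'[THEN conjunct2] hit'' eq')
qed

text \<open>A compact-valued case of the Kuratowski-Ryll-Nardzewski theorem. Once all coordinates
  have been minimized in turn, a single point is left, and the preimage of a closed set under the
  selection is the set of \<open>w\<close> at which the reduced values hit it.\<close>

lemma measurable_selection:
  fixes A :: "'m \<Rightarrow> 'b::euclidean_space set"
  assumes "\<And>w. w \<in> space M \<Longrightarrow> compact (A w) \<and> A w \<noteq> {}"
    and "\<And>C. closed C \<Longrightarrow> {w \<in> space M. A w \<inter> C \<noteq> {}} \<in> sets M"
  obtains s where "s \<in> borel_measurable M" "\<And>w. w \<in> space M \<Longrightarrow> s w \<in> A w"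
proof -
  obtain A' where *: "\<forall>w \<in> space M. compact (A' w) \<and> A' w \<noteq> {} \<and> A' w \<subseteq> A w \<and>
             (\<forall>x \<in> A' w. \<forall>y \<in> A' w. \<forall>b \<in> Basis. x \<bullet> b = y \<bullet> b)"
    and hit: "\<forall>C. closed C \<longrightarrow> {w \<in> space M. A' w \<inter> C \<noteq> {}} \<in> sets M"
  proof -
    have "\<exists>A'. (\<forall>w \<in> space M. compact (A' w) \<and> A' w \<noteq> {} \<and> A' w \<subseteq> A w \<and>
             (\<forall>x \<in> A' w. \<forall>y \<in> A' w. \<forall>b \<in> Basis. x \<bullet> b = y \<bullet> b)) \<and>
           (\<forall>C. closed C \<longrightarrow> {w \<in> space M. A' w \<inter> C \<noteq> {}} \<in> sets M)"
      by (rule measurable_selection_coordinates) (use assms in simp_all)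
    then show thesis
      using that by (elim exE conjE)
  qed
  have A': "A' w \<noteq> {} \<and> A' w \<subseteq> A w" if "w \<in> space M" for w
    using * that by blast
  have eq: "x \<bullet> c = y \<bullet> c" if "w \<in> space M" "x \<in> A' w" "y \<in> A' w" "c \<in> Basis" for w x y c
    using * that by blast
  define s where "s w = (SOME x. x \<in> A' w)" for w
  have s: "s w \<in> A' w" if "w \<in> space M" for w
    using A'[OF that] unfolding s_def by (simp add: some_in_eq)
  have single: "A' w = {s w}" if "w \<in> space M" for w
  proof -
    have "x = s w" if "x \<in> A' w" for x
      by (rule euclidean_eqI) (rule eq[OF \<open>w \<in> space M\<close> that s[OF \<open>w \<in> space M\<close>]])
    then show ?thesis
      using s[OF that] by blast
  qed
  have "s \<in> borel_measurable M"
  proof (rule borel_measurableI)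
    fix S :: "'b set" assume "open S"
    then have "{w \<in> space M. A' w \<inter> - S \<noteq> {}} \<in> sets M"
      using hit by auto
    then have "space M - {w \<in> space M. A' w \<inter> - S \<noteq> {}} \<in> sets M"
      by (rule sets.compl_sets)
    moreover have "s -` S \<inter> space M = space M - {w \<in> space M. A' w \<inter> - S \<noteq> {}}"
      using single by (auto simp del: Collect_conj_eq)
    ultimately show "s -` S \<inter> space M \<in> sets M"
      by simp
  qed
  moreover have "s w \<in> A w" if "w \<in> space M" for w
    using s[OF that] A'[OF that] by blast
  ultimately show thesis
    by (rule that)
qed

subsection \<open>Minimizing configurations\<close>

definition radii :: "('a::real_normed_vector) ^ 'n \<Rightarrow> real ^ 'n" where
  "radii x = (\<chi> i. norm (x $ i))"

lemma radii_nth [simp]: "radii x $ i = norm (x $ i)"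
  by (simp add: radii_def)

lemma configurations_iff: "x \<in> configurations r \<longleftrightarrow> radii x = r"
  by (auto simp: configurations_def vec_eq_iff)

lemma continuous_on_radii: "continuous_on S (radii :: ('a::real_normed_vector) ^ 'n \<Rightarrow> real ^ 'n)"
  unfolding radii_def by (intro continuous_intros)

lemma norm_radii: "norm (radii x) = norm x"
  by (simp add: norm_vec_def)

text \<open>In \<open>ennreal\<close> the value \<top> at a collision is the limit of nearby values,
  so continuity holds at collisions too and compactness applies to all configurations.\<close>

lemma continuous_on_coulomb: "continuous_on S (coulomb :: ('a::real_normed_vector) ^ 'n \<Rightarrow> ennreal)"
  unfolding coulomb_def divide_ennreal_def
  by (simp, intro continuous_on_sum continuous_on_inverse_ennreal continuous_on_ennreal continuous_intros)

text \<open>Since \<open>radii\<close> preserves the norm, preimages of a convergent sequence are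
  bounded and have a convergent subsequence. Sublevel sets of constrained infima are images of this
  kind.\<close>

lemma closed_radii_image:
  fixes S :: "(('a::euclidean_space) ^ 'n) set"
  assumes "closed S"
  shows "closed (radii ` S)"
  unfolding closed_sequential_limits
proof (intro allI impI, elim conjE)
  fix r l assume "\<forall>n. r n \<in> radii ` S" and lim: "r \<longlonglongrightarrow> l"
  then have "\<forall>n. \<exists>x. x \<in> S \<and> r n = radii x"
    by blast
  from choice[OF this] obtain x where x: "\<And>n. x n \<in> S" "\<And>n. r n = radii (x n)"
    by blast
  have "bounded (range x)"
    using convergent_imp_bounded[OF lim]
    by (auto simp: bounded_iff x norm_radii)
  then obtain y \<sigma> where y: "strict_mono \<sigma>" "(x \<circ> \<sigma>) \<longlonglongrightarrow> y"
    using bounded_imp_convergent_subsequence by metis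
  have "y \<in> S"
    by (rule closed_sequentially[OF assms _ y(2)]) (simp add: x)
  moreover have "(\<lambda>n. radii ((x \<circ> \<sigma>) n)) \<longlonglongrightarrow> radii y"
    unfolding radii_def by (intro tendsto_intros y(2))
  moreover have "(\<lambda>n. radii ((x \<circ> \<sigma>) n)) \<longlonglongrightarrow> l"
    using LIMSEQ_subseq_LIMSEQ[OF lim y(1)] by (simp add: comp_def x)
  ultimately show "l \<in> radii ` S"
    using LIMSEQ_unique by blast
qed

lemma compact_configurations: "compact (configurations r :: (('a::euclidean_space) ^ 'n) set)"
proof -
  have "configurations r = (radii -` {r} :: ('a ^ 'n) set)"
    by (auto simp: configurations_iff)
  moreover have "closed (radii -` {r} :: ('a ^ 'n) set)"
    by (intro closed_vimage continuous_on_radii closed_singleton)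
  moreover have "bounded (configurations r :: ('a ^ 'n) set)"
  proof (rule boundedI)
    fix x :: "'a ^ 'n" assume "x \<in> configurations r"
    then show "norm x \<le> norm r"
      using norm_radii[of x] by (simp add: configurations_iff)
  qed
  ultimately show ?thesis
    by (simp add: compact_eq_bounded_closed)
qed

lemma configurations_nonempty:
  assumes "\<And>i. 0 \<le> r $ i"
  shows "configurations r \<noteq> ({} :: (('a::euclidean_space) ^ 'n) set)"
proof -
  have "(\<chi> i. r $ i *\<^sub>R (SOME b. b \<in> Basis) :: 'a ^ 'n) \<in> configurations r"
    using assms by (simp add: configurations_def)
  then show ?thesis
    by blast
qed

definition minimizers :: "real ^ 'n \<Rightarrow> (('a::euclidean_space) ^ 'n) set" where
  "minimizers r = {x \<in> configurations r. coulomb x = reduced_cost TYPE('a) r}"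

lemma minimizers_iff:
  fixes x :: "('a::euclidean_space) ^ 'n"
  shows "x \<in> minimizers r \<longleftrightarrow> x \<in> configurations r \<and> (\<forall>y \<in> (configurations r :: ('a ^ 'n) set). coulomb x \<le> coulomb y)"
proof -
  have "coulomb x = (INF y \<in> (configurations r :: ('a ^ 'n) set). coulomb y) \<longleftrightarrow> (\<forall>y \<in> (configurations r :: ('a ^ 'n) set). coulomb x \<le> coulomb y)"
    if "x \<in> configurations r"
    using INF_lower[OF that, of coulomb] unfolding order.eq_iff[of "coulomb x"] le_INF_iff by blast
  then show ?thesis
    unfolding minimizers_def reduced_cost_def by blast
qed

lemma coulomb_attains_inf:
  fixes C :: "(('a::euclidean_space) ^ 'n) set"
  assumes "closed C" "configurations r \<inter> C \<noteq> {}"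
  obtains x where "x \<in> configurations r \<inter> C" "\<And>y. y \<in> configurations r \<inter> C \<Longrightarrow> coulomb x \<le> coulomb y"
proof -
  have "\<exists>x \<in> configurations r \<inter> C. \<forall>y \<in> configurations r \<inter> C. coulomb x \<le> coulomb y"
    using assms by (intro continuous_attains_inf continuous_on_coulomb compact_Int_closed compact_configurations)
  then show thesis
    using that by blast
qed

lemma minimizers_nonempty:
  assumes "\<And>i. 0 \<le> r $ i"
  shows "minimizers r \<noteq> ({} :: (('a::euclidean_space) ^ 'n) set)"
proof -
  have "configurations r \<inter> UNIV \<noteq> ({} :: ('a ^ 'n) set)"
    using configurations_nonempty[OF assms] by simp
  from coulomb_attains_inf[OF closed_UNIV this] obtain x :: "'a ^ 'n"
    where "x \<in> configurations r \<inter> UNIV" "\<And>y :: 'a ^ 'n. y \<in> configurations r \<inter> UNIV \<Longrightarrow> coulomb x \<le> coulomb y"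
    by blast
  then have "x \<in> minimizers r"
    by (simp add: minimizers_iff)
  then show ?thesis
    by blast
qed

lemma compact_minimizers: "compact (minimizers r :: (('a::euclidean_space) ^ 'n) set)"
proof -
  have "minimizers r = configurations r \<inter> (coulomb -` {reduced_cost TYPE('a) r} :: ('a ^ 'n) set)"
    by (auto simp: minimizers_def)
  then show ?thesis
    by (simp add: compact_Int_closed compact_configurations closed_vimage continuous_on_coulomb)
qed

text \<open>Nonempty constrained infima are attained, so for finite \<open>c\<close> the sublevel
  set is the image under \<open>radii\<close> of a closed set. At \<open>c = \<top>\<close> it is
  the whole space, including radii that admit no configuration in \<open>C\<close>.\<close>

lemma borel_measurable_constrained_cost:
  fixes C :: "(('a::euclidean_space) ^ 'n) set"
  assumes "closed C"
  shows "(\<lambda>r. INF x \<in> configurations r \<inter> C. coulomb x) \<in> borel_measurable borel"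
proof (rule borel_measurableI_le)
  fix c :: ennreal
  show "{r \<in> space borel. (INF x \<in> configurations r \<inter> C. coulomb x) \<le> c} \<in> sets borel"
  proof (cases "c = \<top>")
    case False
    have "(INF x \<in> configurations r \<inter> C. coulomb x) \<le> c \<longleftrightarrow> r \<in> radii ` (C \<inter> coulomb -` {..c})" for r
    proof
      assume le: "(INF x \<in> configurations r \<inter> C. coulomb x) \<le> c"
      have nonempty: "configurations r \<inter> C \<noteq> {}"
        using le False by (auto simp: top_unique)
      obtain x where x: "x \<in> configurations r \<inter> C"
        "\<And>y. y \<in> configurations r \<inter> C \<Longrightarrow> coulomb x \<le> coulomb y"
        using coulomb_attains_inf[OF assms nonempty] by blast
      then have "coulomb x \<le> c"
        using le by (intro order_trans[OF INF_greatest le]) auto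
      then show "r \<in> radii ` (C \<inter> coulomb -` {..c})"
        using x by (auto simp: configurations_iff)
    next
      assume "r \<in> radii ` (C \<inter> coulomb -` {..c})"
      then obtain x where "x \<in> configurations r \<inter> C" "coulomb x \<le> c"
        by (auto simp: configurations_iff)
      then show "(INF x \<in> configurations r \<inter> C. coulomb x) \<le> c"
        by (rule INF_lower2)
    qed
    then have "{r \<in> space borel. (INF x \<in> configurations r \<inter> C. coulomb x) \<le> c} = radii ` (C \<inter> coulomb -` {..c})"
      by auto
    also have "closed \<dots>"
      by (intro closed_radii_image closed_Int assms closed_vimage continuous_on_coulomb closed_atMost)
    finally show ?thesis
      by (rule borel_closed)
  qed simp
qed

lemma borel_measurable_reduced_cost [measurable]:
  "reduced_cost TYPE('a::euclidean_space) \<in> borel_measurable borel"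
  using borel_measurable_constrained_cost[of "UNIV :: ('a ^ 'n) set"]
  by (simp add: reduced_cost_def[abs_def])

lemma minimizers_hit_measurable:
  fixes C :: "(('a::euclidean_space) ^ 'n) set"
  assumes "closed C"
  shows "{r. minimizers r \<inter> C \<noteq> {}} \<in> sets borel"
proof -
  \<comment> \<open>Equality of the infima alone is not enough: the infimum over an empty set is
    \<top> and would match an infinite reduced cost. Membership in the image of \<open>C\<close>
    excludes this.\<close>
  have "minimizers r \<inter> C \<noteq> {} \<longleftrightarrow>
      r \<in> radii ` C \<and> (INF x \<in> configurations r \<inter> C. coulomb x) = reduced_cost TYPE('a) r" for r
  proof
    assume "minimizers r \<inter> C \<noteq> {}"
    then obtain x where x: "x \<in> configurations r \<inter> C" "coulomb x = reduced_cost TYPE('a) r"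
      by (auto simp: minimizers_def)
    then have "(INF x \<in> configurations r \<inter> C. coulomb x) \<le> reduced_cost TYPE('a) r"
      using INF_lower[OF x(1), of coulomb] by simp
    moreover have "reduced_cost TYPE('a) r \<le> (INF x \<in> configurations r \<inter> C. coulomb x)"
      unfolding reduced_cost_def by (rule INF_superset_mono) auto
    ultimately show "r \<in> radii ` C \<and> (INF x \<in> configurations r \<inter> C. coulomb x) = reduced_cost TYPE('a) r"
      using x by (auto simp: configurations_iff)
  next
    assume r: "r \<in> radii ` C \<and> (INF x \<in> configurations r \<inter> C. coulomb x) = reduced_cost TYPE('a) r"
    then have "configurations r \<inter> C \<noteq> {}"
      by (auto simp: configurations_iff)
    then obtain x where x: "x \<in> configurations r \<inter> C"
      "\<And>y. y \<in> configurations r \<inter> C \<Longrightarrow> coulomb x \<le> coulomb y"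
      using coulomb_attains_inf[OF assms] by blast
    then have "coulomb x = (INF x \<in> configurations r \<inter> C. coulomb x)"
      by (intro order.antisym INF_greatest INF_lower)
    then show "minimizers r \<inter> C \<noteq> {}"
      using x r by (auto simp: minimizers_def)
  qed
  then have "{r. minimizers r \<inter> C \<noteq> {}} = radii ` C \<inter>
      {r \<in> space borel. (INF x \<in> configurations r \<inter> C. coulomb x) = reduced_cost TYPE('a) r}"
    by auto
  also have "\<dots> \<in> sets borel"
    using borel_measurable_constrained_cost[OF assms]
    by (intro sets.Int borel_closed closed_radii_image assms borel_measurable_eq borel_measurable_reduced_cost)
  finally show ?thesis .
qed

lemma measurable_minimizer:
  obtains s :: "real ^ 'n \<Rightarrow> ('a::euclidean_space) ^ 'n" where "s \<in> borel_measurable borel"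
    "\<And>r. (\<And>i. 0 \<le> r $ i) \<Longrightarrow> s r \<in> minimizers r"
proof -
  define P :: "(real ^ 'n) set" where "P = {r. \<forall>i. 0 \<le> r $ i}"
  \<comment> \<open>A vector with a negative entry admits no configuration; the dummy value
    \<open>{0}\<close> keeps the selection problem solvable there.\<close>
  define A :: "real ^ 'n \<Rightarrow> ('a ^ 'n) set" where "A r = (if r \<in> P then minimizers r else {0})" for r
  have "P = (\<Inter>i. {r. 0 \<le> r $ i})"
    by (auto simp: P_def)
  also have "closed \<dots>"
    by (intro closed_INT ballI closed_Collect_le continuous_intros)
  finally have P: "P \<in> sets borel"
    by (rule borel_closed)
  have 1: "compact (A r) \<and> A r \<noteq> {}" for r
    using minimizers_nonempty compact_minimizers by (auto simp: A_def P_def)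
  have 2: "{r \<in> space borel. A r \<inter> C \<noteq> {}} \<in> sets borel" if "closed C" for C
  proof -
    have "{r \<in> space borel. A r \<inter> C \<noteq> {}} = (P \<inter> {r. minimizers r \<inter> C \<noteq> {}}) \<union> (if 0 \<in> C then - P else {})"
      by (auto simp: A_def split: if_splits)
    then show ?thesis
      using minimizers_hit_measurable[OF that] P by (auto simp: borel_comp)
  qed
  obtain s where s: "s \<in> borel_measurable borel" "\<And>r. s r \<in> A r"
    by (rule measurable_selection[of borel A]) (use 1 2 in auto)
  have "s r \<in> minimizers r" if "\<And>i. 0 \<le> r $ i" for r
    using s(2)[of r] that by (simp add: A_def P_def)
  with s(1) show thesis
    by (rule that)
qed

subsection \<open>Degenerate minimizers\<close>

text \<open>Real-valued so that it can be differentiated. Collisions count as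
  \<open>1 / 0 = 0\<close> here, so it stands in for \<open>coulomb\<close> only at configurations
  of distinct points.\<close>

definition energy :: "('a::real_normed_vector) ^ 'n \<Rightarrow> real" where
  "energy x = (\<Sum>i\<in>UNIV. \<Sum>j\<in>UNIV - {i}. 1 / norm (x $ i - x $ j))"

lemma coulomb_eq_energy:
  assumes "inj (\<lambda>i. x $ i)"
  shows "coulomb x = ennreal (energy x)"
proof -
  have "1 / ennreal (norm (x $ i - x $ j)) = ennreal (1 / norm (x $ i - x $ j))" if "j \<in> UNIV - {i}" for i j
  proof -
    have "x $ i \<noteq> x $ j"
      using assms that by (auto dest: injD)
    then show ?thesis
      by (subst ennreal_1[symmetric], subst divide_ennreal) auto
  qed
  then have "coulomb x = (\<Sum>i\<in>UNIV. \<Sum>j\<in>UNIV - {i}. ennreal (1 / norm (x $ i - x $ j)))"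
    unfolding coulomb_def by (intro sum.cong refl) blast
  also have "\<dots> = ennreal (energy x)"
    unfolding energy_def by (simp add: sum_ennreal sum_nonneg del: divide_const_simps)
  finally show ?thesis .
qed

lemma inj_configuration:
  assumes "inj (\<lambda>i. r $ i)" "x \<in> configurations r"
  shows "inj (\<lambda>i. x $ i)"
  using assms by (auto simp: configurations_def inj_def) metis

lemma minimizer_energy_le:
  fixes y z :: "('a::euclidean_space) ^ 'n"
  assumes "inj (\<lambda>i. r $ i)" "y \<in> minimizers r" "z \<in> configurations r"
  shows "energy y \<le> energy z"
proof -
  have y: "y \<in> configurations r" and "coulomb y \<le> coulomb z"
    using assms(2,3) by (auto simp: minimizers_iff)
  moreover have "0 \<le> energy z"
    unfolding energy_def by (intro sum_nonneg) auto
  ultimately show ?thesis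
    using assms by (simp add: coulomb_eq_energy inj_configuration)
qed

text \<open>Tangent line to the strictly convex function t \<mapsto> 1 / sqrt t at the square of
  \<open>a\<close>, evaluated at the square of \<open>b\<close>. Squares are the right variable
  because, for fixed radii, squared distances are affine in the Gram matrix.\<close>

lemma inverse_tangent_le:
  fixes a b :: real
  assumes "0 < a" "0 < b"
  shows "1 / a - (b\<^sup>2 - a\<^sup>2) / (2 * a ^ 3) \<le> 1 / b"
    and "a \<noteq> b \<Longrightarrow> 1 / a - (b\<^sup>2 - a\<^sup>2) / (2 * a ^ 3) < 1 / b"
proof -
  have eq: "1 / b - (1 / a - (b\<^sup>2 - a\<^sup>2) / (2 * a ^ 3)) = (a - b)\<^sup>2 * (2 * a + b) / (2 * a ^ 3 * b)"
    using assms by (simp add: power2_eq_square power3_eq_cube divide_simps) (simp add: algebra_simps)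
  have "0 \<le> (a - b)\<^sup>2 * (2 * a + b) / (2 * a ^ 3 * b)"
    using assms by simp
  then show "1 / a - (b\<^sup>2 - a\<^sup>2) / (2 * a ^ 3) \<le> 1 / b"
    using eq by linarith
  assume "a \<noteq> b"
  then have "0 < (a - b)\<^sup>2 * (2 * a + b) / (2 * a ^ 3 * b)"
    using assms by simp
  then show "1 / a - (b\<^sup>2 - a\<^sup>2) / (2 * a ^ 3) < 1 / b"
    using eq by linarith
qed

lemma norm_diff_square: "(norm (u - v))\<^sup>2 = (norm u)\<^sup>2 + (norm v)\<^sup>2 - 2 * (u \<bullet> v :: real)"
  by (simp add: power2_norm_eq_inner inner_diff_left inner_diff_right inner_commute)

lemma first_variation_nonneg:
  fixes x y :: "('a::euclidean_space) ^ 'n"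
  assumes inj: "inj (\<lambda>i. r $ i)" and x: "x \<in> configurations r" and y: "y \<in> minimizers r"
    and e: "norm e = 1" "\<And>i. e \<bullet> y $ i = 0" and k: "norm k = 1"
  shows "(\<Sum>i\<in>UNIV. \<Sum>j\<in>UNIV - {i}.
      (((x $ i \<bullet> k)\<^sup>2 / (r $ i)\<^sup>2 + (x $ j \<bullet> k)\<^sup>2 / (r $ j)\<^sup>2) * (y $ i \<bullet> y $ j)
        - 2 * (x $ i \<bullet> k) * (x $ j \<bullet> k)) / norm (y $ i - y $ j) ^ 3) \<le> 0"
proof -
  \<comment> \<open>The share of the squared radius held by coordinate \<open>k\<close> of
    \<open>x\<close>; removing this share from \<open>y\<close> pays for the component along
    \<open>e\<close>. For a point at the origin both numerator and quotient are 0.\<close>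
  define \<alpha> where "\<alpha> i = (x $ i \<bullet> k)\<^sup>2 / (r $ i)\<^sup>2" for i
  define q where "q i j d = (r $ i)\<^sup>2 + (r $ j)\<^sup>2 - 2 * (sqrt (1 - d * \<alpha> i) * sqrt (1 - d * \<alpha> j) * (y $ i \<bullet> y $ j)
      + d * ((x $ i \<bullet> k) * (x $ j \<bullet> k)))" for i j d
  \<comment> \<open>Written through \<open>q\<close>, the energy makes sense on both sides of 0 and
    is differentiable at 0, whereas it belongs to an actual configuration only for
    \<open>0 \<le> d \<le> 1\<close>.\<close>
  define g where "g d = (\<Sum>i\<in>UNIV. \<Sum>j\<in>UNIV - {i}. 1 / sqrt (q i j d))" for d
  define c where "c i j = (\<alpha> i + \<alpha> j) * (y $ i \<bullet> y $ j) - 2 * (x $ i \<bullet> k) * (x $ j \<bullet> k)" for i j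
  have norm_x: "norm (x $ i) = r $ i" and norm_y: "norm (y $ i) = r $ i" for i
    using x y by (auto simp: configurations_def minimizers_def)
  have \<alpha>_r: "\<alpha> i * (r $ i)\<^sup>2 = (x $ i \<bullet> k)\<^sup>2" for i
    using norm_x[of i] by (auto simp: \<alpha>_def)
  have \<alpha>_le: "\<alpha> i \<le> 1" for i
  proof -
    have "\<bar>x $ i \<bullet> k\<bar> \<le> \<bar>r $ i\<bar>"
      using Cauchy_Schwarz_ineq2[of "x $ i" k] norm_x[of i] k by simp
    then show ?thesis
      by (simp add: \<alpha>_def divide_le_eq_1 abs_le_square_iff)
  qed
  have q_0: "q i j 0 = (norm (y $ i - y $ j))\<^sup>2" for i j
    by (simp add: q_def norm_diff_square norm_y)
  have y_neq: "y $ i \<noteq> y $ j" if "i \<noteq> j" for i j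
    using inj norm_y that by (metis injD)
  \<comment> \<open>The displacement along \<open>e\<close> has size of order \<open>sqrt d\<close>,
    not differentiable at 0. Orthogonality of \<open>e\<close> to all points of \<open>y\<close>
    removes the mixed terms, so inner products contain only its square and are differentiable in
    \<open>d\<close>.\<close>
  define z where "z d = (\<chi> i. sqrt (1 - d * \<alpha> i) *\<^sub>R y $ i + (sqrt d * (x $ i \<bullet> k)) *\<^sub>R e)" for d
  have inner_z: "z d $ i \<bullet> z d $ j = sqrt (1 - d * \<alpha> i) * sqrt (1 - d * \<alpha> j) * (y $ i \<bullet> y $ j)
      + d * ((x $ i \<bullet> k) * (x $ j \<bullet> k))" if "0 \<le> d" for d i j
  proof -
    have "e \<bullet> e = 1" "y $ l \<bullet> e = 0" for l
      using e by (simp_all add: norm_eq_1 inner_commute)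
    then have "z d $ i \<bullet> z d $ j = sqrt (1 - d * \<alpha> i) * sqrt (1 - d * \<alpha> j) * (y $ i \<bullet> y $ j)
        + (sqrt d * sqrt d) * ((x $ i \<bullet> k) * (x $ j \<bullet> k))"
      using e(2) by (simp add: z_def inner_add_left inner_add_right)
    then show ?thesis
      using that by simp
  qed
  have z_conf: "z d \<in> configurations r" if "0 \<le> d" "d \<le> 1" for d
  proof -
    have "norm (z d $ i) = r $ i" for i
    proof -
      have "d * \<alpha> i \<le> 1"
        using that \<alpha>_le[of i] by (intro mult_le_one) (auto simp: \<alpha>_def)
      then have "(norm (z d $ i))\<^sup>2 = (1 - d * \<alpha> i) * (r $ i)\<^sup>2 + d * (x $ i \<bullet> k)\<^sup>2"
        by (simp add: power2_norm_eq_inner inner_z that)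
          (simp add: power2_norm_eq_inner[symmetric] norm_y power2_eq_square)
      also have "\<dots> = (r $ i)\<^sup>2"
        by (simp add: \<alpha>_r[symmetric] algebra_simps)
      finally show ?thesis
        using norm_y[of i] by (metis norm_ge_zero power2_eq_iff_nonneg)
    qed
    then show ?thesis
      by (simp add: configurations_def)
  qed
  have energy_z: "energy (z d) = g d" if "0 \<le> d" "d \<le> 1" for d
  proof -
    have "norm (z d $ i - z d $ j) = sqrt (q i j d)" for i j
    proof -
      have "(norm (z d $ i - z d $ j))\<^sup>2 = q i j d"
        using z_conf[OF that] by (simp add: norm_diff_square inner_z that q_def configurations_def)
      then show ?thesis
        by (metis norm_ge_zero real_sqrt_unique)
    qed
    then show ?thesis
      by (simp add: energy_def g_def)
  qed
  have q_deriv: "(q i j has_real_derivative c i j) (at 0)" for i j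
    unfolding q_def c_def by (auto intro!: derivative_eq_intros simp: field_simps)
  have term_deriv: "((\<lambda>d. 1 / sqrt (q i j d)) has_real_derivative - (c i j / norm (y $ i - y $ j) ^ 3) / 2) (at 0)"
    if "j \<in> UNIV - {i}" for i j
  proof -
    have pos: "0 < norm (y $ i - y $ j)"
      using y_neq[of i j] that by auto
    have "((\<lambda>d. sqrt (q i j d)) has_real_derivative inverse (sqrt (q i j 0)) / 2 * c i j) (at 0)"
      by (rule DERIV_chain2[OF DERIV_real_sqrt q_deriv]) (use pos in \<open>simp add: q_0\<close>)
    then have "((\<lambda>d. inverse (sqrt (q i j d))) has_real_derivative
        - (inverse (sqrt (q i j 0)) * (inverse (sqrt (q i j 0)) / 2 * c i j) * inverse (sqrt (q i j 0)))) (at 0)"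
      by (rule DERIV_inverse') (use pos in \<open>simp add: q_0\<close>)
    then show ?thesis
      using pos by (simp add: q_0 inverse_eq_divide power3_eq_cube mult_ac)
  qed
  have "(g has_real_derivative (\<Sum>i\<in>UNIV. \<Sum>j\<in>UNIV - {i}. - (c i j / norm (y $ i - y $ j) ^ 3) / 2)) (at 0)"
    unfolding g_def by (intro DERIV_sum term_deriv)
  moreover have "(\<Sum>i\<in>UNIV. \<Sum>j\<in>UNIV - {i}. - (c i j / norm (y $ i - y $ j) ^ 3) / 2)
      = - (\<Sum>i\<in>UNIV. \<Sum>j\<in>UNIV - {i}. c i j / norm (y $ i - y $ j) ^ 3) / 2"
    by (simp add: sum_negf sum_divide_distrib)
  ultimately have deriv: "(g has_real_derivative - (\<Sum>i\<in>UNIV. \<Sum>j\<in>UNIV - {i}. c i j / norm (y $ i - y $ j) ^ 3) / 2) (at 0)"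
    by simp
  have "energy y = g 0"
    by (simp add: energy_def g_def q_0)
  then have min: "g 0 \<le> g d" if "0 \<le> d" "d \<le> 1" for d
    using minimizer_energy_le[OF inj y z_conf[OF that]] energy_z[OF that] by simp
  have "(\<Sum>i\<in>UNIV. \<Sum>j\<in>UNIV - {i}. c i j / norm (y $ i - y $ j) ^ 3) \<le> 0"
  proof (rule ccontr)
    assume "\<not> ?thesis"
    then have "- (\<Sum>i\<in>UNIV. \<Sum>j\<in>UNIV - {i}. c i j / norm (y $ i - y $ j) ^ 3) / 2 < 0"
      by simp
    then obtain h where h: "h > 0" "\<And>t. 0 < t \<Longrightarrow> t < h \<Longrightarrow> g (0 + t) < g 0"
      using has_real_derivative_neg_dec_right[OF deriv] by auto
    define t where "t = min (h / 2) 1"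
    have "0 < t" "t < h" "t \<le> 1"
      using h(1) by (auto simp: t_def)
    then show False
      using h(2)[of t] min[of t] by simp
  qed
  then show ?thesis
    by (simp add: c_def \<alpha>_def)
qed

text \<open>
  The energy is a strictly convex function of the Gram matrix. A minimizer \<open>y\<close> leaving a direction
  \<open>e\<close> unused can be perturbed along \<open>e\<close> by each coordinate of a competitor \<open>x\<close>; the second-order
  variations add up to the derivative of the energy from the Gram matrix of \<open>y\<close> towards that of \<open>x\<close>.
\<close>

lemma degenerate_minimizer_unique:
  fixes x y :: "('a::euclidean_space) ^ 'n"
  assumes inj: "inj (\<lambda>i. r $ i)" and x: "x \<in> minimizers r" and y: "y \<in> minimizers r"
    and e: "norm e = 1" "\<And>i. e \<bullet> y $ i = 0"
  shows "x $ i \<bullet> x $ j = y $ i \<bullet> y $ j"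
proof -
  have conf: "x \<in> configurations r" "y \<in> configurations r"
    using x y by (auto simp: minimizers_def)
  then have norm_x: "norm (x $ i) = r $ i" and norm_y: "norm (y $ i) = r $ i" for i
    by (auto simp: configurations_def)
  define A where "A i j = norm (y $ i - y $ j)" for i j
  define B where "B i j = norm (x $ i - x $ j)" for i j
  have pos: "0 < A i j" "0 < B i j" if "j \<in> UNIV - {i}" for i j
    using inj_configuration[OF inj conf(1)] inj_configuration[OF inj conf(2)] that
    by (auto simp: A_def B_def dest: injD)
  define F where "F k i j = (((x $ i \<bullet> k)\<^sup>2 / (r $ i)\<^sup>2 + (x $ j \<bullet> k)\<^sup>2 / (r $ j)\<^sup>2) * (y $ i \<bullet> y $ j)
        - 2 * (x $ i \<bullet> k) * (x $ j \<bullet> k)) / A i j ^ 3" for k i j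
  have sum_F: "(\<Sum>k\<in>Basis. F k i j) = ((B i j)\<^sup>2 - (A i j)\<^sup>2) / A i j ^ 3" for i j
  proof -
    have "(\<Sum>k\<in>Basis. (x $ i \<bullet> k)\<^sup>2 / (r $ i)\<^sup>2) = 1" if "r $ i \<noteq> 0" for i
    proof -
      have "(\<Sum>k\<in>Basis. (x $ i \<bullet> k)\<^sup>2) = (r $ i)\<^sup>2"
        using norm_x[of i] by (metis (no_types, lifting) euclidean_inner power2_eq_square power2_norm_eq_inner sum.cong)
      then show ?thesis
        using that by (simp flip: sum_divide_distrib)
    qed
    \<comment> \<open>For a point at the origin the shares sum to 0 instead of 1, which is harmless
      because \<open>y $ i = 0\<close> then.\<close>
    then have \<alpha>: "(\<Sum>k\<in>Basis. (x $ i \<bullet> k)\<^sup>2 / (r $ i)\<^sup>2) * (y $ i \<bullet> w) = y $ i \<bullet> w" for i w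
      using norm_y[of i] by (cases "r $ i = 0") auto
    have "(\<Sum>k\<in>Basis. ((x $ i \<bullet> k)\<^sup>2 / (r $ i)\<^sup>2 + (x $ j \<bullet> k)\<^sup>2 / (r $ j)\<^sup>2) * (y $ i \<bullet> y $ j)
        - 2 * (x $ i \<bullet> k) * (x $ j \<bullet> k))
      = (\<Sum>k\<in>Basis. (x $ i \<bullet> k)\<^sup>2 / (r $ i)\<^sup>2) * (y $ i \<bullet> y $ j)
        + (\<Sum>k\<in>Basis. (x $ j \<bullet> k)\<^sup>2 / (r $ j)\<^sup>2) * (y $ j \<bullet> y $ i) - 2 * (x $ i \<bullet> x $ j)"
      by (simp add: euclidean_inner[of "x $ i" "x $ j"] sum.distrib sum_subtractf sum_distrib_right
        sum_distrib_left distrib_right mult.assoc inner_commute[of "y $ j" "y $ i"])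
    also have "\<dots> = 2 * (y $ i \<bullet> y $ j) - 2 * (x $ i \<bullet> x $ j)"
      unfolding \<alpha> by (simp add: inner_commute)
    also have "\<dots> = (B i j)\<^sup>2 - (A i j)\<^sup>2"
      by (simp add: A_def B_def norm_diff_square norm_x norm_y)
    finally show ?thesis
      by (simp add: F_def flip: sum_divide_distrib)
  qed
  define S where "S = (\<Sum>i\<in>UNIV. \<Sum>j\<in>UNIV - {i}. ((B i j)\<^sup>2 - (A i j)\<^sup>2) / (2 * A i j ^ 3))"
  have cancel: "2 * (p / (2 * q)) = p / q" for p q :: real
    by simp
  have "2 * S = (\<Sum>i\<in>UNIV. \<Sum>j\<in>UNIV - {i}. \<Sum>k\<in>Basis. F k i j)"
    unfolding S_def sum_F by (simp only: sum_distrib_left cancel)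
  also have "\<dots> = (\<Sum>i\<in>UNIV. \<Sum>k\<in>Basis. \<Sum>j\<in>UNIV - {i}. F k i j)"
    by (intro sum.cong refl sum.swap)
  also have "\<dots> = (\<Sum>k\<in>Basis. \<Sum>i\<in>UNIV. \<Sum>j\<in>UNIV - {i}. F k i j)"
    by (rule sum.swap)
  also have "\<dots> \<le> 0"
    unfolding F_def A_def
    by (rule sum_nonpos) (rule first_variation_nonneg[OF inj conf(1) y e norm_Basis])
  finally have S: "S \<le> 0"
    by simp
  have energy_eq: "energy x = (\<Sum>i\<in>UNIV. \<Sum>j\<in>UNIV - {i}. 1 / B i j)"
    "energy y = (\<Sum>i\<in>UNIV. \<Sum>j\<in>UNIV - {i}. 1 / A i j)"
    by (simp_all add: energy_def A_def B_def)
  define t where "t i j = 1 / A i j - ((B i j)\<^sup>2 - (A i j)\<^sup>2) / (2 * A i j ^ 3)" for i j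
  have t_le: "t i j \<le> 1 / B i j" if "j \<in> UNIV - {i}" for i j
    unfolding t_def using inverse_tangent_le(1) pos[OF that] .
  have sum_t: "(\<Sum>i\<in>UNIV. \<Sum>j\<in>UNIV - {i}. t i j) = energy y - S"
    by (simp add: t_def energy_eq S_def sum_subtractf)
  \<comment> \<open>The tangent values sum to \<open>energy y - S\<close>, which is at least
    \<open>energy y\<close>. A single differing distance makes the tangent bound strict and puts the
    energy of \<open>x\<close> above that of \<open>y\<close>, against minimality of
    \<open>x\<close>.\<close>
  have "A i j = B i j" if "i \<noteq> j" for i j
  proof (rule ccontr)
    assume neq: "A i j \<noteq> B i j"
    have "(\<Sum>i\<in>UNIV. \<Sum>j\<in>UNIV - {i}. t i j) < (\<Sum>i\<in>UNIV. \<Sum>j\<in>UNIV - {i}. 1 / B i j)"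
    proof (rule sum_strict_mono_ex1)
      show "\<forall>i\<in>UNIV. (\<Sum>j\<in>UNIV - {i}. t i j) \<le> (\<Sum>j\<in>UNIV - {i}. 1 / B i j)"
        using t_le by (auto intro!: sum_mono)
      have "(\<Sum>j\<in>UNIV - {i}. t i j) < (\<Sum>j\<in>UNIV - {i}. 1 / B i j)"
      proof (rule sum_strict_mono_ex1)
        show "\<forall>j\<in>UNIV - {i}. t i j \<le> 1 / B i j"
          using t_le by blast
        show "\<exists>j\<in>UNIV - {i}. t i j < 1 / B i j"
          using inverse_tangent_le(2)[OF pos[of j i] neq] that unfolding t_def by blast
      qed simp
      then show "\<exists>i\<in>UNIV. (\<Sum>j\<in>UNIV - {i}. t i j) < (\<Sum>j\<in>UNIV - {i}. 1 / B i j)"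
        by blast
    qed simp
    then have "energy y < energy x"
      using sum_t S energy_eq by simp
    then show False
      using minimizer_energy_le[OF inj x conf(2)] by simp
  qed
  then have "(B i j)\<^sup>2 = (A i j)\<^sup>2"
    by (cases "i = j") (auto simp: A_def B_def)
  then show ?thesis
    by (simp add: A_def B_def norm_diff_square norm_x norm_y)
qed

lemma span_eq_UNIV_iff:
  fixes S :: "'a::euclidean_space set"
  shows "span S = UNIV \<longleftrightarrow> \<not> (\<exists>e. norm e = 1 \<and> (\<forall>v \<in> S. e \<bullet> v = 0))"
proof
  assume span: "span S = UNIV"
  show "\<not> (\<exists>e. norm e = 1 \<and> (\<forall>v \<in> S. e \<bullet> v = 0))"
  proof
    assume "\<exists>e. norm e = 1 \<and> (\<forall>v \<in> S. e \<bullet> v = 0)"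
    then obtain e where e: "norm e = 1" "\<And>v. v \<in> S \<Longrightarrow> orthogonal e v"
      by (auto simp: orthogonal_def)
    then have "orthogonal e e"
      using span by (intro orthogonal_to_span[of e S]) auto
    then show False
      using e(1) by (simp add: orthogonal_self)
  qed
next
  assume *: "\<not> (\<exists>e. norm e = 1 \<and> (\<forall>v \<in> S. e \<bullet> v = 0))"
  show "span S = UNIV"
  proof (rule ccontr)
    assume "span S \<noteq> UNIV"
    then obtain a where a: "a \<noteq> 0" "\<And>v. v \<in> span S \<Longrightarrow> a \<bullet> v = 0"
      using span_not_UNIV_orthogonal[of S] by blast
    then have "norm (a /\<^sub>R norm a) = 1 \<and> (\<forall>v \<in> S. (a /\<^sub>R norm a) \<bullet> v = 0)"
      by (auto simp: span_base)
    then show False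
      using * by blast
  qed
qed

text \<open>If \<open>y\<close> did not span, the Gram matrices would agree and sending each point
  of \<open>x\<close> to the corresponding point of \<open>y\<close> would embed the whole space
  isometrically into the hyperplane orthogonal to \<open>e\<close>, which the dimension
  forbids.\<close>

lemma minimizers_span:
  fixes x y :: "('a::euclidean_space) ^ 'n"
  assumes inj: "inj (\<lambda>i. r $ i)" and x: "x \<in> minimizers r" "span (range (\<lambda>i. x $ i)) = UNIV"
    and y: "y \<in> minimizers r"
  shows "span (range (\<lambda>i. y $ i)) = UNIV"
proof (rule ccontr)
  assume "span (range (\<lambda>i. y $ i)) \<noteq> UNIV"
  then obtain e where e: "norm e = 1" "\<And>i. e \<bullet> y $ i = 0"
    by (auto simp: span_eq_UNIV_iff)
  have gram: "x $ i \<bullet> x $ j = y $ i \<bullet> y $ j" for i j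
    using degenerate_minimizer_unique[OF inj x(1) y e] .
  have inj_x: "inj (\<lambda>i. x $ i)"
    using inj x(1) by (auto simp: minimizers_def intro: inj_configuration)
  have "\<exists>c. v = (\<Sum>i\<in>UNIV. c i *\<^sub>R x $ i)" for v
  proof -
    have "v \<in> span (range (\<lambda>i. x $ i))"
      using x(2) by simp
    then obtain u where "v = (\<Sum>w\<in>range (\<lambda>i. x $ i). u w *\<^sub>R w)"
      by (auto simp: span_finite)
    then have "v = (\<Sum>i\<in>UNIV. u (x $ i) *\<^sub>R x $ i)"
      by (simp add: sum.reindex[OF inj_x])
    then show ?thesis
      by (rule exI[of _ "\<lambda>i. u (x $ i)"])
  qed
  then have "\<forall>v. \<exists>c. v = (\<Sum>i\<in>UNIV. c i *\<^sub>R x $ i)"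
    by blast
  from choice[OF this] obtain c where c: "\<And>v. v = (\<Sum>i\<in>UNIV. c v i *\<^sub>R x $ i)"
    by blast
  \<comment> \<open>The coefficients \<open>c\<close> are an arbitrary choice, so linearity of
    \<open>f\<close> is not evident. Preservation of inner products suffices: it makes the image of
    the standard basis orthonormal.\<close>
  define f where "f v = (\<Sum>i\<in>UNIV. c v i *\<^sub>R y $ i)" for v
  have inner_f: "f u \<bullet> f v = u \<bullet> v" for u v
  proof -
    have "f u \<bullet> f v = (\<Sum>i\<in>UNIV. c u i *\<^sub>R x $ i) \<bullet> (\<Sum>i\<in>UNIV. c v i *\<^sub>R x $ i)"
      by (simp add: f_def inner_sum_left inner_sum_right gram)
    then show ?thesis
      by (simp flip: c)
  qed
  have "e \<bullet> f v = 0" for v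
    using e(2) by (simp add: f_def inner_sum_right)
  then have "\<not> (span (f ` Basis) = UNIV)"
    using e(1) by (subst span_eq_UNIV_iff) blast
  moreover have "span (f ` Basis) = UNIV"
  proof -
    have inj_f: "inj_on f Basis"
      using inner_f by (metis (no_types, lifting) inj_onI inner_Basis zero_neq_one)
    have "pairwise orthogonal (f ` Basis)"
      by (auto simp: pairwise_def orthogonal_def inner_f inner_Basis)
    moreover have "0 \<notin> f ` Basis"
      using inner_f by (metis imageE inner_Basis inner_zero_left zero_neq_one)
    ultimately have "independent (f ` Basis)"
      by (rule pairwise_orthogonal_independent)
    moreover have "card (f ` Basis) = DIM('a)"
      by (rule card_image[OF inj_f])
    ultimately show ?thesis
      using card_ge_dim_independent[of "f ` Basis" UNIV] by auto
  qed
  ultimately show False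
    by contradiction
qed

text \<open>Otherwise non-spanning minimizers with unit normals would exist at radii converging to
  \<open>r\<close>. A common subsequence converges, and its limit is a minimizer at \<open>r\<close>
  that still has a unit normal.\<close>

lemma minimizers_span_nearby:
  fixes x :: "('a::euclidean_space) ^ 'n"
  assumes inj: "inj (\<lambda>i. r $ i)" and x: "x \<in> minimizers r" "span (range (\<lambda>i. x $ i)) = UNIV"
  obtains \<epsilon> where "\<epsilon> > 0"
    "\<And>s (y :: 'a ^ 'n). dist s r < \<epsilon> \<Longrightarrow> y \<in> minimizers s \<Longrightarrow> span (range (\<lambda>i. y $ i)) = UNIV"
proof -
  have "\<exists>\<epsilon>>0. \<forall>s. \<forall>y :: 'a ^ 'n. dist s r < \<epsilon> \<longrightarrow> y \<in> minimizers s \<longrightarrow> span (range (\<lambda>i. y $ i)) = UNIV"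
  proof (rule ccontr)
    assume not: "\<not> ?thesis"
    have "\<exists>y e. dist (radii y) r < inverse (Suc n) \<and> (y :: 'a ^ 'n) \<in> minimizers (radii y)
        \<and> norm e = 1 \<and> (\<forall>i. e \<bullet> y $ i = 0)" for n
    proof -
      have "inverse (Suc n) > (0::real)"
        by simp
      with not obtain s and y :: "'a ^ 'n" where sy: "dist s r < inverse (Suc n)" "y \<in> minimizers s"
        "span (range (\<lambda>i. y $ i)) \<noteq> UNIV"
        by blast
      moreover have "radii y = s"
        using sy(2) by (simp add: minimizers_def configurations_iff)
      ultimately show ?thesis
        by (auto simp: span_eq_UNIV_iff)
    qed
    then have "\<forall>n. \<exists>p. dist (radii (fst p)) r < inverse (Suc n) \<and> (fst p :: 'a ^ 'n) \<in> minimizers (radii (fst p))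
        \<and> norm (snd p) = 1 \<and> (\<forall>i. snd p \<bullet> fst p $ i = 0)"
      by simp
    from choice[OF this] obtain p where
      p: "\<And>n. dist (radii (fst (p n))) r < inverse (Suc n)" "\<And>n. (fst (p n) :: 'a ^ 'n) \<in> minimizers (radii (fst (p n)))"
      "\<And>n. norm (snd (p n)) = 1" "\<And>n i. snd (p n) \<bullet> fst (p n) $ i = 0"
      by blast
    have lim_radii: "(\<lambda>n. radii (fst (p n))) \<longlonglongrightarrow> r"
      unfolding tendsto_iff
    proof (intro allI impI)
      fix e :: real assume "e > 0"
      then have "\<forall>\<^sub>F n in sequentially. inverse (real (Suc n)) < e"
        using LIMSEQ_inverse_real_of_nat by (rule order_tendstoD(2)[rotated])
      then show "\<forall>\<^sub>F n in sequentially. dist (radii (fst (p n))) r < e"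
        by eventually_elim (use p(1) in \<open>rule less_trans\<close>)
    qed
    have "bounded (range p)"
    proof -
      obtain b where b: "\<And>n. norm (radii (fst (p n))) \<le> b"
        using convergent_imp_bounded[OF lim_radii] by (auto simp: bounded_iff)
      have "norm (p n) \<le> b + 1" for n
        using norm_Pair_le[of "fst (p n)" "snd (p n)"] b[of n] by (simp add: p(3) norm_radii)
      then show ?thesis
        by (intro boundedI[of _ "b + 1"]) auto
    qed
    then obtain l \<sigma> where \<sigma>: "strict_mono \<sigma>" and lim: "(p \<circ> \<sigma>) \<longlonglongrightarrow> l"
      using bounded_imp_convergent_subsequence by metis
    have lim1: "(\<lambda>n. fst (p (\<sigma> n))) \<longlonglongrightarrow> fst l" and lim2: "(\<lambda>n. snd (p (\<sigma> n))) \<longlonglongrightarrow> snd l"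
      using tendsto_fst[OF lim] tendsto_snd[OF lim] by (simp_all add: comp_def)
    have lim_r: "(\<lambda>n. radii (fst (p (\<sigma> n)))) \<longlonglongrightarrow> r"
      using LIMSEQ_subseq_LIMSEQ[OF lim_radii \<sigma>] by (simp add: comp_def)
    have "(\<lambda>n. radii (fst (p (\<sigma> n)))) \<longlonglongrightarrow> radii (fst l)"
      unfolding radii_def by (intro tendsto_intros lim1)
    then have r: "radii (fst l) = r"
      using lim_r LIMSEQ_unique by blast
    have "(\<lambda>n. norm (snd (p (\<sigma> n)))) \<longlonglongrightarrow> norm (snd l)"
      by (intro tendsto_intros lim2)
    then have norm_l: "norm (snd l) = 1"
      by (simp add: p(3) LIMSEQ_const_iff)
    have orth_l: "snd l \<bullet> fst l $ i = 0" for i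
    proof -
      have "(\<lambda>n. snd (p (\<sigma> n)) \<bullet> fst (p (\<sigma> n)) $ i) \<longlonglongrightarrow> snd l \<bullet> fst l $ i"
        by (intro tendsto_intros lim1 lim2)
      then show ?thesis
        by (simp add: p(4) LIMSEQ_const_iff)
    qed
    have radii_x: "radii x = r"
      using x(1) by (simp add: minimizers_def configurations_iff)
    obtain b :: 'a where b: "norm b = 1"
      using norm_Basis nonempty_Basis by blast
    \<comment> \<open>Moving \<open>x\<close> along its rays to the nearby radii gives competitors
      converging to \<open>x\<close>, which show that the limit is minimal. A point of
      \<open>x\<close> at the origin has no ray, but nearby radii may be positive, so some unit
      vector is supplied.\<close>
    define u where "u i = (if x $ i = 0 then b else sgn (x $ i))" for i
    have u: "norm (u i) = 1" "norm (x $ i) *\<^sub>R u i = x $ i" for i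
      using b by (auto simp: u_def norm_sgn sgn_div_norm)
    define z where "z s = (\<chi> i. s $ i *\<^sub>R u i)" for s :: "real ^ 'n"
    have "coulomb (fst (p (\<sigma> n))) \<le> coulomb (z (radii (fst (p (\<sigma> n)))))" for n
    proof -
      have "z (radii (fst (p (\<sigma> n)))) \<in> configurations (radii (fst (p (\<sigma> n))))"
        by (simp add: configurations_def z_def u)
      then show ?thesis
        using p(2)[of "\<sigma> n"] by (simp add: minimizers_iff)
    qed
    moreover have "(\<lambda>n. coulomb (fst (p (\<sigma> n)))) \<longlonglongrightarrow> coulomb (fst l)"
      by (rule continuous_on_tendsto_compose[OF continuous_on_coulomb[of UNIV] lim1]) auto
    moreover have "(\<lambda>n. coulomb (z (radii (fst (p (\<sigma> n)))))) \<longlonglongrightarrow> coulomb x"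
    proof -
      have "(\<lambda>n. z (radii (fst (p (\<sigma> n))))) \<longlonglongrightarrow> z r"
        unfolding z_def by (intro tendsto_intros lim_r)
      moreover have "z r = x"
        using u(2) by (simp add: z_def vec_eq_iff flip: radii_x)
      ultimately show ?thesis
        by (intro continuous_on_tendsto_compose[OF continuous_on_coulomb[of UNIV]]) auto
    qed
    ultimately have "coulomb (fst l) \<le> coulomb x"
      by (intro LIMSEQ_le) auto
    then have "fst l \<in> minimizers r"
      using x(1) r unfolding minimizers_iff configurations_iff by (meson order_trans)
    then have "span (range (\<lambda>i. fst l $ i)) = UNIV"
      by (rule minimizers_span[OF inj x])
    then show False
      using norm_l orth_l by (auto simp: span_eq_UNIV_iff)
  qed
  then show thesis
    using that by blast
qed

subsection \<open>Gram-Schmidt orthogonalization\<close>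

text \<open>Left unnormalized, so that orthogonality holds for every sequence: a vanishing vector
  has coefficient 0, by the convention for division by zero.\<close>

fun gram_schmidt :: "(nat \<Rightarrow> 'a::real_inner) \<Rightarrow> nat \<Rightarrow> 'a" where
  "gram_schmidt g k = g k - (\<Sum>j<k. (g k \<bullet> gram_schmidt g j / (gram_schmidt g j \<bullet> gram_schmidt g j)) *\<^sub>R gram_schmidt g j)"

declare gram_schmidt.simps [simp del]

lemma gram_schmidt_orthogonal: "i < k \<Longrightarrow> gram_schmidt g k \<bullet> gram_schmidt g i = 0"
proof (induction k arbitrary: i rule: less_induct)
  case (less k)
  have zero: "gram_schmidt g j \<bullet> gram_schmidt g i = 0" if "j < k" "j \<noteq> i" for j
    using less.IH[of j i] less.IH[of i j] that less.prems
    by (cases "i < j") (auto simp: inner_commute)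
  have "(\<Sum>j<k. (g k \<bullet> gram_schmidt g j / (gram_schmidt g j \<bullet> gram_schmidt g j)) * (gram_schmidt g j \<bullet> gram_schmidt g i))
      = (\<Sum>j<k. if j = i then g k \<bullet> gram_schmidt g i else 0)"
    by (intro sum.cong refl) (auto simp: zero)
  then show ?case
    using less.prems by (subst gram_schmidt.simps) (simp add: inner_diff_left inner_sum_left)
qed

text \<open>The recursion consists of inner products and linear combinations only. This equivariance
  is the source of the invariance of the random rotation.\<close>

lemma gram_schmidt_equivariant:
  assumes "orthogonal_transformation T"
  shows "gram_schmidt (\<lambda>m. T (g m)) k = T (gram_schmidt g k)"
proof (induction k rule: less_induct)
  case (less k)
  have lin: "linear T" and inner: "\<And>u v. T u \<bullet> T v = u \<bullet> v"
    using assms by (auto simp: orthogonal_transformation_def)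
  have "gram_schmidt (\<lambda>m. T (g m)) k = T (g k) - (\<Sum>j<k. (T (g k) \<bullet> T (gram_schmidt g j) /
      (T (gram_schmidt g j) \<bullet> T (gram_schmidt g j))) *\<^sub>R T (gram_schmidt g j))"
    by (subst gram_schmidt.simps) (simp add: less)
  also have "\<dots> = T (gram_schmidt g k)"
    by (subst (4) gram_schmidt.simps) (simp add: inner linear_diff[OF lin] linear_sum[OF lin] linear_scale[OF lin])
  finally show ?case .
qed

lemma gram_schmidt_nonzero:
  assumes "g k \<notin> span (g ` {..<k})"
  shows "gram_schmidt g k \<noteq> 0"
proof
  have in_span: "gram_schmidt g j \<in> span (g ` {..j})" for j
  proof (induction j rule: less_induct)
    case (less j)
    have "gram_schmidt g i \<in> span (g ` {..j})" if "i < j" for i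
    proof -
      have "span (g ` {..i}) \<subseteq> span (g ` {..j})"
        using that by (intro span_mono image_mono) auto
      then show ?thesis
        using less[OF that] by blast
    qed
    moreover have "g j \<in> span (g ` {..j})"
      by (intro span_base) simp
    ultimately show ?case
      by (subst gram_schmidt.simps) (intro span_diff span_sum span_scale; simp)
  qed
  assume "gram_schmidt g k = 0"
  then have eq: "g k = (\<Sum>j<k. (g k \<bullet> gram_schmidt g j / (gram_schmidt g j \<bullet> gram_schmidt g j)) *\<^sub>R gram_schmidt g j)"
    by (subst (asm) gram_schmidt.simps) simp
  have "gram_schmidt g j \<in> span (g ` {..<k})" if "j < k" for j
  proof -
    have "span (g ` {..j}) \<subseteq> span (g ` {..<k})"
      using that by (intro span_mono image_mono) auto
    then show ?thesis
      using in_span[of j] by blast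
  qed
  then have "(\<Sum>j<k. (g k \<bullet> gram_schmidt g j / (gram_schmidt g j \<bullet> gram_schmidt g j)) *\<^sub>R gram_schmidt g j) \<in> span (g ` {..<k})"
    by (intro span_sum span_scale) auto
  then show False
    using assms eq by simp
qed

lemma borel_measurable_gram_schmidt:
  fixes g :: "nat \<Rightarrow> 'm \<Rightarrow> 'a::euclidean_space"
  assumes "\<And>m. g m \<in> borel_measurable M"
  shows "(\<lambda>w. gram_schmidt (\<lambda>m. g m w) k) \<in> borel_measurable M"
proof (induction k rule: less_induct)
  case (less k)
  note assms [measurable]
  have [measurable]: "(\<lambda>w. gram_schmidt (\<lambda>m. g m w) j) \<in> borel_measurable M" if "j \<in> {..<k}" for j
    using less that by simp
  show ?case
    by (subst gram_schmidt.simps) measurable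
qed

subsection \<open>Random rotations\<close>

text \<open>A fixed orthogonal map of determinant -1. The flipped coordinate is an arbitrary choice
  because the index type has no distinguished element.\<close>

definition reflection :: "real ^ 'd \<Rightarrow> real ^ 'd" where
  "reflection v = (\<chi> i. if i = (SOME k. True) then - v $ i else v $ i)"

lemma orthogonal_transformation_reflection: "orthogonal_transformation (reflection :: real ^ 'd \<Rightarrow> real ^ 'd)"
  unfolding orthogonal_transformation_def
proof
  show "linear (reflection :: real ^ 'd \<Rightarrow> real ^ 'd)"
    by (rule linearI) (auto simp: reflection_def vec_eq_iff)
  show "\<forall>v w. reflection v \<bullet> reflection w = v \<bullet> (w :: real ^ 'd)"
    by (auto simp: reflection_def inner_vec_def intro!: sum.cong)
qed

lemma det_reflection: "det (matrix (reflection :: real ^ 'd \<Rightarrow> real ^ 'd)) = -1"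
proof -
  let ?k = "SOME k :: 'd. True"
  have entry: "matrix (reflection :: real ^ 'd \<Rightarrow> real ^ 'd) $ i $ j = (if i = j then if i = ?k then -1 else 1 else 0)" for i j
    by (auto simp: matrix_def reflection_def axis_def)
  have "det (matrix (reflection :: real ^ 'd \<Rightarrow> real ^ 'd)) = (\<Prod>i\<in>UNIV. if i = ?k then -1 else 1)"
    by (subst det_diagonal) (simp_all add: entry)
  then show ?thesis
    by (simp add: prod.delta)
qed

lemma det_transformed_rows:
  fixes T :: "real ^ 'd \<Rightarrow> real ^ 'd"
  assumes "linear T"
  shows "det (\<chi> k. T (g k)) = det (matrix T) * det (\<chi> k. g k)"
proof -
  have "(\<chi> k. T (g k)) = (\<chi> k. g k) ** transpose (matrix T)"
  proof -
    have "T (g k) $ i = (\<Sum>j\<in>UNIV. g k $ j * matrix T $ i $ j)" for k i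
    proof -
      have "T (g k) = matrix T *v g k"
        using fun_cong[OF matrix_vector_mul(2)[OF assms], of "g k"] by (rule sym)
      then show ?thesis
        by (simp add: matrix_vector_mult_def mult.commute)
    qed
    then show ?thesis
      by (simp add: vec_eq_iff matrix_matrix_mult_def transpose_def)
  qed
  then show ?thesis
    by (simp add: det_mul)
qed

text \<open>Gram-Schmidt processes rows in an order, which the index type does not carry; an
  arbitrary one is fixed here.\<close>

definition enumeration :: "nat \<Rightarrow> 'd::finite" where
  "enumeration = (SOME h. bij_betw h {0..<CARD('d)} UNIV)"

lemma bij_betw_enumeration: "bij_betw (enumeration :: nat \<Rightarrow> 'd::finite) {0..<CARD('d)} UNIV"
  unfolding enumeration_def using ex_bij_betw_nat_finite[OF finite[of "UNIV :: 'd set"]] by (rule someI_ex)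

definition orthonormal_rows :: "real ^ 'd ^ 'd \<Rightarrow> real ^ 'd ^ 'd" where
  "orthonormal_rows G = (\<chi> k. sgn (gram_schmidt (\<lambda>m. G $ enumeration m)
     (inv_into {0..<CARD('d)} enumeration k)))"

lemma orthonormal_rows_equivariant:
  assumes "orthogonal_transformation T"
  shows "orthonormal_rows (\<chi> k. T (G $ k)) = (\<chi> k. T (orthonormal_rows G $ k))"
proof -
  have "sgn (T v) = T (sgn v)" for v
    using assms by (simp add: sgn_div_norm orthogonal_transformation_norm linear_scale orthogonal_transformation_linear)
  then show ?thesis
    by (simp add: orthonormal_rows_def gram_schmidt_equivariant[OF assms])
qed

lemma orthogonal_matrix_orthonormal_rows_det:
  fixes G :: "real ^ 'd ^ 'd"
  assumes "det G \<noteq> 0"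
  shows "orthogonal_matrix (orthonormal_rows G)"
proof -
  let ?idx = "inv_into {0..<CARD('d)} (enumeration :: nat \<Rightarrow> 'd)"
  let ?b = "gram_schmidt (\<lambda>m. G $ enumeration m)"
  have idx: "?idx k < CARD('d)" "enumeration (?idx k) = k" for k
    using bij_betw_enumeration[where 'd = 'd] inv_into_into[of k enumeration "{0..<CARD('d)}"]
      f_inv_into_f[of k enumeration "{0..<CARD('d)}"] by (auto simp: bij_betw_def)
  have idx_inj: "?idx k \<noteq> ?idx l" if "k \<noteq> l" for k l
    using idx(2) that by metis
  \<comment> \<open>\<open>rows G\<close> is a set, and its independence says nothing about repeated
    rows. Distinctness ensures that the earlier rows survive the removal of
    \<open>G $ k\<close>.\<close>
  have rows_neq: "G $ i \<noteq> G $ j" if "i \<noteq> j" for i j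
    using det_identical_rows[OF that, of G] assms by (auto simp: row_def vec_eq_iff)
  have indep: "independent (rows G)"
    using det_dependent_rows[of G] assms by (auto simp: dependent_vec_eq)
  have "?b (?idx k) \<noteq> 0" for k
  proof (rule gram_schmidt_nonzero)
    have "(\<lambda>m. G $ enumeration m) ` {..<?idx k} \<subseteq> rows G - {G $ k}"
    proof (intro image_subsetI DiffI)
      fix m assume m: "m \<in> {..<?idx k}"
      show "G $ enumeration m \<in> rows G"
        by (auto simp: rows_def row_def vec_eq_iff)
      have "m < CARD('d)"
        using m idx(1)[of k] by simp
      then have "enumeration m \<noteq> (enumeration (?idx k) :: 'd)"
        using m idx(1)[of k] inj_on_eq_iff[OF bij_betw_imp_inj_on[OF bij_betw_enumeration[where 'd = 'd]], of m "?idx k"]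
        by simp
      then show "G $ enumeration m \<notin> {G $ k}"
        using rows_neq idx(2) by auto
    qed
    then have "span ((\<lambda>m. G $ enumeration m) ` {..<?idx k}) \<subseteq> span (rows G - {G $ k})"
      by (rule span_mono)
    moreover have "G $ k \<in> rows G"
      by (auto simp: rows_def row_def)
    then have "G $ k \<notin> span (rows G - {G $ k})"
      using indep by (auto simp: dependent_def)
    ultimately show "G $ enumeration (?idx k) \<notin> span ((\<lambda>m. G $ enumeration m) ` {..<?idx k})"
      unfolding idx(2) by blast
  qed
  then have "norm (row k (orthonormal_rows G)) = 1" for k
    by (simp add: orthonormal_rows_def row_def norm_sgn)
  moreover have "orthogonal (row k (orthonormal_rows G)) (row l (orthonormal_rows G))" if "k \<noteq> l" for k l
  proof -
    have "?b (?idx k) \<bullet> ?b (?idx l) = 0"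
      using gram_schmidt_orthogonal[of "?idx k" "?idx l"] gram_schmidt_orthogonal[of "?idx l" "?idx k"]
        idx_inj[OF that] by (metis inner_commute linorder_neqE_nat)
    moreover have "row i (orthonormal_rows G) = sgn (?b (?idx i))" for i
      by (simp add: row_def orthonormal_rows_def)
    ultimately show ?thesis
      by (simp add: orthogonal_def sgn_div_norm)
  qed
  ultimately show ?thesis
    by (simp add: orthogonal_matrix_orthonormal_rows)
qed

section \<open>Measurability of vector and matrix operations\<close>

lemma borel_measurable_vec_lambda [measurable (raw)]:
  fixes f :: "'m \<Rightarrow> 'n::finite \<Rightarrow> 'a::euclidean_space"
  assumes "\<And>i. (\<lambda>w. f w i) \<in> borel_measurable M"
  shows "(\<lambda>w. \<chi> i. f w i) \<in> borel_measurable M"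
proof -
  note assms [measurable]
  have "(\<lambda>w. (\<chi> i. f w i) \<bullet> b) \<in> borel_measurable M" for b :: "'a ^ 'n"
    unfolding inner_vec_def by simp
  then show ?thesis
    by (subst borel_measurable_euclidean_space) blast
qed

lemma borel_measurable_vec_nth [measurable (raw)]:
  fixes f :: "'m \<Rightarrow> ('a::euclidean_space) ^ 'n"
  assumes "f \<in> borel_measurable M"
  shows "(\<lambda>w. f w $ i) \<in> borel_measurable M"
  using assms by (rule borel_measurable_continuous_on[rotated]) (intro continuous_intros)

lemma borel_measurable_matrix_vector_mult [measurable (raw)]:
  fixes f :: "'m \<Rightarrow> real ^ 'd ^ 'd"
  assumes [measurable]: "f \<in> borel_measurable M" "g \<in> borel_measurable M"
  shows "(\<lambda>w. f w *v g w) \<in> borel_measurable M"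
  unfolding matrix_vector_mult_def by measurable

lemma borel_measurable_det [measurable (raw)]:
  fixes f :: "'m \<Rightarrow> real ^ 'd ^ 'd"
  assumes [measurable]: "f \<in> borel_measurable M"
  shows "(\<lambda>w. det (f w)) \<in> borel_measurable M"
  unfolding det_def by measurable

lemma borel_measurable_reflection [measurable]: "reflection \<in> borel_measurable borel"
  unfolding reflection_def[abs_def] by measurable

lemma borel_measurable_orthonormal_rows [measurable]: "orthonormal_rows \<in> borel_measurable borel"
  unfolding orthonormal_rows_def[abs_def]
  by (intro borel_measurable_vec_lambda measurable_compose[OF borel_measurable_gram_schmidt sgn_borel_measurable])
    measurable

text \<open>The correcting reflection multiplies from the left. Rotating all rows of
  \<open>G\<close> multiplies from the right, so the correction does not disturb
  equivariance.\<close>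

definition to_rotation :: "real ^ 'd ^ 'd \<Rightarrow> real ^ 'd ^ 'd" where
  "to_rotation G = (let A = orthonormal_rows G in if det A = 1 then A else matrix reflection ** A)"

lemma rotation_to_rotation:
  fixes G :: "real ^ 'd ^ 'd"
  assumes "det G \<noteq> 0"
  shows "orthogonal_matrix (to_rotation G)" "det (to_rotation G) = 1"
proof -
  let ?A = "orthonormal_rows G"
  have A: "orthogonal_matrix ?A"
    using orthogonal_matrix_orthonormal_rows_det[OF assms] .
  have R: "orthogonal_matrix (matrix (reflection :: real ^ 'd \<Rightarrow> real ^ 'd))"
    using orthogonal_transformation_reflection unfolding orthogonal_transformation_matrix by blast
  show "orthogonal_matrix (to_rotation G)"
    using A R by (simp add: to_rotation_def Let_def orthogonal_matrix_mul)
  show "det (to_rotation G) = 1"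
    using det_orthogonal_matrix[OF A] by (auto simp: to_rotation_def Let_def det_mul det_reflection)
qed

lemma borel_measurable_to_rotation [measurable]: "to_rotation \<in> borel_measurable borel"
proof -
  have "(\<lambda>G. matrix reflection ** orthonormal_rows G) \<in> borel_measurable (borel :: (real ^ 'd ^ 'd) measure)"
    unfolding matrix_matrix_mult_def by measurable
  then show ?thesis
    unfolding to_rotation_def[abs_def] Let_def by measurable
qed

text \<open>Applying \<open>T\<close> to every row multiplies the matrix on the right by the
  transpose of \<open>T\<close>, which cancels against \<open>T w\<close>. Determinant 1 keeps both
  sides in the same branch of \<open>to_rotation\<close>.\<close>

lemma to_rotation_equivariant:
  fixes G :: "real ^ 'd ^ 'd"
  assumes T: "orthogonal_transformation T" and det: "det (matrix T) = 1"
  shows "to_rotation (\<chi> k. T (G $ k)) *v T w = to_rotation G *v w"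
proof -
  have "(\<chi> k. T (A $ k)) *v T w = A *v w" for A :: "real ^ 'd ^ 'd"
  proof -
    have "(\<chi> k. T (A $ k)) *v T w = (\<chi> k. T (A $ k) \<bullet> T w)"
      by (simp add: matrix_vector_mult_def inner_vec_def)
    also have "\<dots> = A *v w"
      using T by (simp add: orthogonal_transformation_def) (simp add: matrix_vector_mult_def inner_vec_def)
    finally show ?thesis .
  qed
  moreover have "det (\<chi> k. T (A $ k)) = det A" for A :: "real ^ 'd ^ 'd"
    using det_transformed_rows[OF orthogonal_transformation_linear[OF T], of "\<lambda>k. A $ k"] by (simp add: det)
  ultimately show ?thesis
    by (simp add: to_rotation_def Let_def orthonormal_rows_equivariant[OF T] flip: matrix_vector_mul_assoc)
qed

section \<open>The law of a random rotation\<close>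

lemma distr_orthogonal_uniform_measure:
  fixes T :: "'a::euclidean_space \<Rightarrow> 'a"
  assumes T: "orthogonal_transformation T" and D [measurable]: "D \<in> sets borel"
    and invariant: "\<And>x. T x \<in> D \<longleftrightarrow> x \<in> D"
  shows "distr (uniform_measure lborel D) borel T = uniform_measure lborel D"
proof -
  note [measurable] = borel_measurable_orthogonal_transformation[OF T]
  have [measurable]: "(\<lambda>x. indicator D x / emeasure lborel D) \<in> borel_measurable lborel"
    by (intro borel_measurable_divide_ennreal borel_measurable_indicator) auto
  have "distr (density lborel (\<lambda>x. indicator D (T x) / emeasure lborel D)) borel T
      = density (distr lborel borel T) (\<lambda>x. indicator D x / emeasure lborel D)"
    by (subst density_distr) auto
  then show ?thesis
    unfolding uniform_measure_def by (simp add: distr_orthogonal_lborel[OF T] indicator_def invariant)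
qed

text \<open>Bounded and of positive measure, hence the carrier of a uniform probability measure; the
  norm ball and, for rotations, the determinant are invariant under rotating all rows.\<close>

definition nondegenerate_matrices :: "(real ^ 'd ^ 'd) set" where
  "nondegenerate_matrices = {G \<in> ball 0 1. det G \<noteq> 0}"

lemma nondegenerate_matrices_measurable [measurable]: "nondegenerate_matrices \<in> sets borel"
  unfolding nondegenerate_matrices_def by measurable

lemma emeasure_nondegenerate_matrices:
  "emeasure lborel (nondegenerate_matrices :: (real ^ 'd ^ 'd) set) \<noteq> 0"
  "emeasure lborel (nondegenerate_matrices :: (real ^ 'd ^ 'd) set) \<noteq> \<infinity>"
proof -
  let ?D = "nondegenerate_matrices :: (real ^ 'd ^ 'd) set"
  have cont: "continuous_on UNIV (det :: real ^ 'd ^ 'd \<Rightarrow> real)"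
    unfolding det_def by (intro continuous_intros)
  have "?D = ball 0 1 \<inter> det -` (- {0})"
    by (auto simp: nondegenerate_matrices_def)
  also have "open \<dots>"
    by (intro open_Int open_vimage cont) auto
  finally have "open ?D" .
  define c where "c = inverse (norm (mat 1 :: real ^ 'd ^ 'd) + 1)"
  have c: "0 < c" "c * norm (mat 1 :: real ^ 'd ^ 'd) < 1"
  proof -
    have pos: "0 < norm (mat 1 :: real ^ 'd ^ 'd) + 1"
      by (rule add_nonneg_pos) auto
    then show "0 < c"
      by (simp add: c_def)
    then have "c * norm (mat 1 :: real ^ 'd ^ 'd) < c * (norm (mat 1 :: real ^ 'd ^ 'd) + 1)"
      by simp
    also have "\<dots> = 1"
      using pos by (simp add: c_def)
    finally show "c * norm (mat 1 :: real ^ 'd ^ 'd) < 1" .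
  qed
  have "c *\<^sub>R mat 1 = (mat c :: real ^ 'd ^ 'd)"
    by (simp add: mat_def vec_eq_iff)
  moreover have "det (mat c :: real ^ 'd ^ 'd) = c ^ CARD('d)"
    by (subst det_diagonal) (auto simp: mat_def)
  moreover have "norm (c *\<^sub>R mat 1 :: real ^ 'd ^ 'd) < 1"
    using c by simp
  ultimately have "mat c \<in> ?D"
    using c(1) by (simp add: nondegenerate_matrices_def)
  then have "?D \<noteq> {}"
    by blast
  then have "?D \<notin> null_sets lborel"
    using open_not_negligible[OF \<open>open ?D\<close>] null_sets_completionI[of ?D lborel]
    by (auto simp: negligible_iff_null_sets)
  then show "emeasure lborel ?D \<noteq> 0"
    by (simp add: null_sets_def)
  have "emeasure lborel ?D \<le> emeasure lborel (ball (0 :: real ^ 'd ^ 'd) 1)"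
    by (intro emeasure_mono) (auto simp: nondegenerate_matrices_def)
  then show "emeasure lborel ?D \<noteq> \<infinity>"
    using emeasure_unit_ball(2)[where 'a = "real ^ 'd ^ 'd"] by (auto simp: top_unique)
qed

text \<open>A concrete form of Haar measure on SO(d), entering below only through the laws of the
  vectors \<open>A *v w\<close>.\<close>

definition random_rotation :: "(real ^ 'd ^ 'd) measure" where
  "random_rotation = distr (uniform_measure lborel nondegenerate_matrices) borel to_rotation"

lemma sets_random_rotation [simp, measurable_cong]: "sets random_rotation = sets borel"
  by (simp add: random_rotation_def)

lemma prob_space_random_rotation: "prob_space (random_rotation :: (real ^ 'd ^ 'd) measure)"
  unfolding random_rotation_def
  by (rule prob_space.prob_space_distr[OF prob_space_uniform_measure])
    (use emeasure_nondegenerate_matrices in auto)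

lemma AE_random_rotation:
  "AE A in (random_rotation :: (real ^ 'd ^ 'd) measure). orthogonal_matrix A \<and> det A = 1"
proof -
  have "AE G in uniform_measure lborel (nondegenerate_matrices :: (real ^ 'd ^ 'd) set).
      orthogonal_matrix (to_rotation G) \<and> det (to_rotation G) = 1"
    by (rule AE_uniform_measureI) (auto simp: nondegenerate_matrices_def rotation_to_rotation)
  moreover have "{A. orthogonal_matrix A \<and> det A = 1} \<in> sets (borel :: (real ^ 'd ^ 'd) measure)"
    unfolding orthogonal_matrix matrix_matrix_mult_def transpose_def by measurable
  ultimately show ?thesis
    unfolding random_rotation_def by (subst AE_distr_iff) auto
qed

text \<open>Rotating all rows at once is an orthogonal map of the space of matrices, so it preserves
  the uniform law of \<open>G\<close>; by equivariance it absorbs the \<open>T\<close> in front of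
  \<open>w\<close>.\<close>

lemma distr_random_rotation_vector_invariant:
  assumes T: "orthogonal_transformation T" and det: "det (matrix T) = 1"
  shows "distr random_rotation borel (\<lambda>A :: real ^ 'd ^ 'd. A *v T w) = distr random_rotation borel (\<lambda>A. A *v w)"
proof -
  let ?M = "uniform_measure lborel (nondegenerate_matrices :: (real ^ 'd ^ 'd) set)"
  let ?F = "\<lambda>G :: real ^ 'd ^ 'd. \<chi> k. T (G $ k)"
  have F: "orthogonal_transformation ?F"
    using T unfolding orthogonal_transformation_def
    by (auto simp: inner_vec_def vec_eq_iff linear_add linear_scale intro!: linearI)
  have det_F: "det (?F G) = det G" for G
    using det_transformed_rows[OF orthogonal_transformation_linear[OF T], of "\<lambda>k. G $ k"] by (simp add: det)
  have M: "distr ?M borel ?F = ?M"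
    by (rule distr_orthogonal_uniform_measure[OF F])
      (auto simp: nondegenerate_matrices_def det_F orthogonal_transformation_norm[OF F])
  have [measurable]: "?F \<in> borel_measurable borel"
    by (rule borel_measurable_orthogonal_transformation[OF F])
  have "distr random_rotation borel (\<lambda>A :: real ^ 'd ^ 'd. A *v T w) = distr ?M borel (\<lambda>G. to_rotation G *v T w)"
    unfolding random_rotation_def by (subst distr_distr) (auto simp: comp_def)
  also have "\<dots> = distr (distr ?M borel ?F) borel (\<lambda>G. to_rotation G *v T w)"
    by (simp only: M)
  also have "\<dots> = distr ?M borel (\<lambda>G. to_rotation (?F G) *v T w)"
    by (subst distr_distr) (auto simp: comp_def)
  also have "\<dots> = distr ?M borel (\<lambda>G. to_rotation G *v w)"
    by (simp add: to_rotation_equivariant[OF T det])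
  also have "\<dots> = distr random_rotation borel (\<lambda>A. A *v w)"
    unfolding random_rotation_def by (subst distr_distr) (auto simp: comp_def)
  finally show ?thesis .
qed

text \<open>
  By invariance the law of \<open>A u\<close> does not depend on the unit vector \<open>u\<close>, so \<open>u\<close> may be taken uniform
  and independent of \<open>A\<close>; then \<open>A u\<close> is uniform for each fixed \<open>A\<close>.
\<close>

lemma distr_random_rotation_unit_vector:
  fixes u :: "real ^ 'd"
  assumes "2 \<le> CARD('d)" "norm u = 1"
  shows "distr random_rotation borel (\<lambda>A. A *v u) = uniform_sphere"
proof (rule measure_eqI)
  let ?\<nu> = "random_rotation :: (real ^ 'd ^ 'd) measure"
  let ?\<sigma> = "uniform_sphere :: (real ^ 'd) measure"
  show "sets (distr ?\<nu> borel (\<lambda>A. A *v u)) = sets ?\<sigma>"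
    by simp
  fix B assume "B \<in> sets (distr ?\<nu> borel (\<lambda>A. A *v u))"
  then have B [measurable]: "B \<in> sets borel"
    by simp
  interpret \<nu>: prob_space ?\<nu> by (rule prob_space_random_rotation)
  interpret \<sigma>: prob_space ?\<sigma> by (rule prob_space_uniform_sphere)
  interpret pair_sigma_finite ?\<nu> ?\<sigma> ..
  have const: "(\<integral>\<^sup>+ A. indicator B (A *v w) \<partial>?\<nu>) = emeasure (distr ?\<nu> borel (\<lambda>A. A *v u)) B"
    if w: "norm w = 1" for w
  proof -
    \<comment> \<open>Here the dimension matters: on the line, no orthogonal map of determinant 1
      takes a unit vector to its opposite.\<close>
    obtain T where T: "orthogonal_transformation T" "det (matrix T) = 1" "T w = u"
      using rotation_exists[OF assms(1), of w u] w assms(2) by auto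
    have "(\<integral>\<^sup>+ A. indicator B (A *v w) \<partial>?\<nu>) = emeasure (distr ?\<nu> borel (\<lambda>A. A *v w)) B"
      by (subst nn_integral_indicator[symmetric], simp) (subst nn_integral_distr, auto)
    then show ?thesis
      using distr_random_rotation_vector_invariant[OF T(1,2), of w] T(3) by simp
  qed
  have "emeasure (distr ?\<nu> borel (\<lambda>A. A *v u)) B
      = (\<integral>\<^sup>+ w. emeasure (distr ?\<nu> borel (\<lambda>A. A *v u)) B \<partial>?\<sigma>)"
    by (simp add: \<sigma>.emeasure_space_1)
  also have "\<dots> = (\<integral>\<^sup>+ w. (\<integral>\<^sup>+ A. indicator B (A *v w) \<partial>?\<nu>) \<partial>?\<sigma>)"
    using AE_uniform_sphere by (intro nn_integral_cong_AE) (auto simp: const)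
  also have "\<dots> = (\<integral>\<^sup>+ A. (\<integral>\<^sup>+ w. indicator B (A *v w) \<partial>?\<sigma>) \<partial>?\<nu>)"
    by (rule Fubini') measurable
  also have "\<dots> = (\<integral>\<^sup>+ A. emeasure ?\<sigma> B \<partial>?\<nu>)"
  proof (rule nn_integral_cong_AE)
    show "AE A in ?\<nu>. (\<integral>\<^sup>+ w. indicator B (A *v w) \<partial>?\<sigma>) = emeasure ?\<sigma> B"
      using AE_random_rotation
    proof eventually_elim
      case (elim A)
      then have A: "orthogonal_transformation ((*v) A)"
        by (simp add: orthogonal_transformation_matrix)
      have "(\<integral>\<^sup>+ w. indicator B (A *v w) \<partial>?\<sigma>) = emeasure (distr ?\<sigma> borel ((*v) A)) B"
        by (subst nn_integral_indicator[symmetric], simp) (subst nn_integral_distr, auto)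
      then show ?case
        by (simp add: distr_orthogonal_uniform_sphere[OF A])
    qed
  qed
  also have "\<dots> = emeasure ?\<sigma> B"
    by (simp add: \<nu>.emeasure_space_1)
  finally show "emeasure (distr ?\<nu> borel (\<lambda>A. A *v u)) B = emeasure ?\<sigma> B" .
qed

subsection \<open>Optimal couplings\<close>

lemma measure_eqI_nn_integral:
  assumes "sets M = sets N" "\<And>g. g \<in> borel_measurable N \<Longrightarrow> (\<integral>\<^sup>+ x. g x \<partial>M) = (\<integral>\<^sup>+ x. g x \<partial>N)"
  shows "M = N"
proof (rule measure_eqI)
  fix B assume "B \<in> sets M"
  then show "emeasure M B = emeasure N B"
    using assms(2)[of "indicator B"] by (simp add: assms(1))
qed (rule assms(1))

lemma distr_eqI_nn_integral:
  assumes [measurable]: "h \<in> M \<rightarrow>\<^sub>M borel" and "sets N = sets borel"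
    and "\<And>g. g \<in> borel_measurable borel \<Longrightarrow> (\<integral>\<^sup>+ x. g (h x) \<partial>M) = (\<integral>\<^sup>+ x. g x \<partial>N)"
  shows "distr M borel h = N"
proof (rule measure_eqI_nn_integral)
  show "sets (distr M borel h) = sets N"
    using assms(2) by simp
  fix g :: "'b \<Rightarrow> ennreal" assume "g \<in> borel_measurable N"
  then have [measurable]: "g \<in> borel_measurable borel"
    by (simp add: measurable_cong_sets[OF assms(2) refl])
  show "(\<integral>\<^sup>+ x. g x \<partial>distr M borel h) = (\<integral>\<^sup>+ x. g x \<partial>N)"
    by (simp add: nn_integral_distr assms(3))
qed

lemma couplings_nn_integral:
  assumes "\<gamma> \<in> couplings \<mu>" "g \<in> borel_measurable borel"
  shows "(\<integral>\<^sup>+ x. g ((x :: ('a::euclidean_space) ^ 'n) $ i) \<partial>\<gamma>) = (\<integral>\<^sup>+ t. g t \<partial>\<mu>)"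
proof -
  have sets: "sets \<gamma> = sets borel" and eq: "distr \<gamma> borel (\<lambda>x. x $ i) = \<mu>"
    using assms(1) by (auto simp: couplings_def)
  have [measurable]: "(\<lambda>x. x $ i) \<in> \<gamma> \<rightarrow>\<^sub>M borel"
    using sets by (simp add: measurable_cong_sets[OF sets refl] borel_measurable_vec_nth)
  show ?thesis
    unfolding eq[symmetric] using assms(2) by (simp add: nn_integral_distr)
qed

lemma couplingsI:
  fixes \<gamma> :: "(('a::euclidean_space) ^ 'n) measure"
  assumes "sets \<gamma> = sets borel" "prob_space \<gamma>" "sets \<mu> = sets borel"
    and "\<And>i g. g \<in> borel_measurable borel \<Longrightarrow> (\<integral>\<^sup>+ x. g (x $ i) \<partial>\<gamma>) = (\<integral>\<^sup>+ t. g t \<partial>\<mu>)"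
  shows "\<gamma> \<in> couplings \<mu>"
proof -
  have "(\<lambda>x. x $ i) \<in> \<gamma> \<rightarrow>\<^sub>M borel" for i
    by (simp add: measurable_cong_sets[OF assms(1) refl] borel_measurable_vec_nth)
  then show ?thesis
    unfolding couplings_def using assms by (auto intro!: distr_eqI_nn_integral)
qed

section \<open>Integration in polar coordinates and the lower bound for the cost\<close>

lemma nn_integral_radial_measure:
  fixes g :: "'a::euclidean_space \<Rightarrow> ennreal"
  assumes [measurable]: "g \<in> borel_measurable borel"
  shows "(\<integral>\<^sup>+ x. g x \<partial>radial_measure f) = (\<integral>\<^sup>+ r. (\<integral>\<^sup>+ \<theta>. g (r *\<^sub>R \<theta>) \<partial>uniform_sphere) \<partial>radial_part f)"
proof -
  interpret \<sigma>: prob_space "uniform_sphere :: 'a measure" by (rule prob_space_uniform_sphere)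
  have [measurable_cong]: "sets (radial_part f) = sets borel"
    by (simp add: radial_part_def)
  have "(\<integral>\<^sup>+ x. g x \<partial>radial_measure f) = (\<integral>\<^sup>+ p. g (fst p *\<^sub>R snd p) \<partial>(radial_part f \<Otimes>\<^sub>M uniform_sphere))"
    unfolding radial_measure_def by (subst nn_integral_distr) (auto simp: case_prod_beta)
  also have "\<dots> = (\<integral>\<^sup>+ r. (\<integral>\<^sup>+ \<theta>. g (r *\<^sub>R \<theta>) \<partial>uniform_sphere) \<partial>radial_part f)"
    by (subst \<sigma>.nn_integral_fst[symmetric]) auto
  finally show ?thesis .
qed

lemma sets_radial_measure [simp]: "sets (radial_measure f) = sets borel"
  by (simp add: radial_measure_def)

lemma sets_radial_part [simp, measurable_cong]: "sets (radial_part f) = sets borel"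
  by (simp add: radial_part_def)

lemma AE_radial_part:
  assumes "f \<in> borel_measurable borel"
  shows "AE r in radial_part f. 0 \<le> r"
  unfolding radial_part_def using assms
  by (subst AE_density) (auto simp: indicator_def)

lemma distr_orthogonal_radial_measure:
  fixes T :: "'a::euclidean_space \<Rightarrow> 'a"
  assumes T: "orthogonal_transformation T"
  shows "distr (radial_measure f) borel T = radial_measure f"
proof (rule distr_eqI_nn_integral)
  have [measurable]: "T \<in> borel_measurable borel"
    by (rule borel_measurable_orthogonal_transformation[OF T])
  then show "T \<in> radial_measure f \<rightarrow>\<^sub>M borel"
    by (simp add: measurable_cong_sets[OF sets_radial_measure refl])
  fix g :: "'a \<Rightarrow> ennreal" assume [measurable]: "g \<in> borel_measurable borel"
  have "(\<integral>\<^sup>+ \<theta>. g (T (r *\<^sub>R \<theta>)) \<partial>uniform_sphere) = (\<integral>\<^sup>+ \<theta>. g (r *\<^sub>R \<theta>) \<partial>uniform_sphere)" for r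
  proof -
    have "(\<integral>\<^sup>+ \<theta>. g (r *\<^sub>R \<theta>) \<partial>distr uniform_sphere borel T) = (\<integral>\<^sup>+ \<theta>. g (r *\<^sub>R T \<theta>) \<partial>uniform_sphere)"
      by (subst nn_integral_distr) auto
    then show ?thesis
      by (simp add: distr_orthogonal_uniform_sphere[OF T] linear_scale[OF orthogonal_transformation_linear[OF T]])
  qed
  then show "(\<integral>\<^sup>+ x. g (T x) \<partial>radial_measure f) = (\<integral>\<^sup>+ x. g x \<partial>radial_measure f)"
    by (simp add: nn_integral_radial_measure)
qed simp

lemma nn_integral_radial_measure_norm:
  fixes g :: "real \<Rightarrow> ennreal"
  assumes f: "f \<in> borel_measurable borel" and [measurable]: "g \<in> borel_measurable borel"
  shows "(\<integral>\<^sup>+ x. g (norm x) \<partial>(radial_measure f :: 'a::euclidean_space measure)) = (\<integral>\<^sup>+ r. g r \<partial>radial_part f)"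
proof -
  interpret \<sigma>: prob_space "uniform_sphere :: 'a measure" by (rule prob_space_uniform_sphere)
  have "(\<integral>\<^sup>+ \<theta>. g (norm (r *\<^sub>R \<theta>)) \<partial>(uniform_sphere :: 'a measure)) = g \<bar>r\<bar>" for r
  proof -
    have "(\<integral>\<^sup>+ \<theta>. g (norm (r *\<^sub>R \<theta>)) \<partial>(uniform_sphere :: 'a measure)) = (\<integral>\<^sup>+ \<theta>. g \<bar>r\<bar> \<partial>(uniform_sphere :: 'a measure))"
      using AE_uniform_sphere by (intro nn_integral_cong_AE) auto
    then show ?thesis
      by (simp add: \<sigma>.emeasure_space_1)
  qed
  then have "(\<integral>\<^sup>+ x. g (norm x) \<partial>(radial_measure f :: 'a measure)) = (\<integral>\<^sup>+ r. g \<bar>r\<bar> \<partial>radial_part f)"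
    by (subst nn_integral_radial_measure) auto
  also have "\<dots> = (\<integral>\<^sup>+ r. g r \<partial>radial_part f)"
    using AE_radial_part[OF f] by (intro nn_integral_cong_AE) auto
  finally show ?thesis .
qed

lemma borel_measurable_coulomb [measurable]:
  "(coulomb :: ('a::euclidean_space) ^ 'n \<Rightarrow> ennreal) \<in> borel_measurable borel"
  by (intro borel_measurable_continuous_onI continuous_on_coulomb)

lemma borel_measurable_radii [measurable]:
  "(radii :: ('a::euclidean_space) ^ 'n \<Rightarrow> real ^ 'n) \<in> borel_measurable borel"
  by (intro borel_measurable_continuous_onI continuous_on_radii)

text \<open>Taking radii turns a coupling of the radial measure into a competitor for the reduced
  problem, and minimizing over the forgotten directions can only lower the cost.\<close>

lemma reduced_minimizer_le_total_cost:
  fixes \<Gamma> :: "(('a::euclidean_space) ^ 'n) measure" and \<gamma> :: "(real ^ 'n) measure"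
  assumes f: "f \<in> borel_measurable borel" and \<gamma>: "reduced_minimizer TYPE('a) (radial_part f) \<gamma>"
    and \<Gamma>: "\<Gamma> \<in> couplings (radial_measure f)"
  shows "(\<integral>\<^sup>+ r. reduced_cost TYPE('a) r \<partial>\<gamma>) \<le> total_cost \<Gamma>"
proof -
  have sets [measurable_cong]: "sets \<Gamma> = sets borel" and prob: "prob_space \<Gamma>"
    using \<Gamma> by (auto simp: couplings_def)
  have "distr \<Gamma> borel radii \<in> couplings (radial_part f)"
  proof (rule couplingsI)
    show "prob_space (distr \<Gamma> borel radii)"
      by (rule prob_space.prob_space_distr[OF prob]) simp
    fix i and g :: "real \<Rightarrow> ennreal" assume [measurable]: "g \<in> borel_measurable borel"
    have "(\<integral>\<^sup>+ r. g (r $ i) \<partial>distr \<Gamma> borel radii) = (\<integral>\<^sup>+ x. g (norm (x $ i)) \<partial>\<Gamma>)"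
      by (subst nn_integral_distr) auto
    also have "\<dots> = (\<integral>\<^sup>+ r. g r \<partial>radial_part f)"
      using couplings_nn_integral[OF \<Gamma>, of "\<lambda>x. g (norm x)" i] nn_integral_radial_measure_norm[OF f, of g]
      by simp
    finally show "(\<integral>\<^sup>+ r. g (r $ i) \<partial>distr \<Gamma> borel radii) = (\<integral>\<^sup>+ r. g r \<partial>radial_part f)" .
  qed auto
  then have "(\<integral>\<^sup>+ r. reduced_cost TYPE('a) r \<partial>\<gamma>) \<le> (\<integral>\<^sup>+ r. reduced_cost TYPE('a) r \<partial>distr \<Gamma> borel radii)"
    using \<gamma> by (auto simp: reduced_minimizer_def)
  also have "\<dots> = (\<integral>\<^sup>+ x. reduced_cost TYPE('a) (radii x) \<partial>\<Gamma>)"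
    by (subst nn_integral_distr) auto
  also have "\<dots> \<le> total_cost \<Gamma>"
    unfolding total_cost_def reduced_cost_def
    by (intro nn_integral_mono INF_lower) (simp add: configurations_iff)
  finally show ?thesis .
qed

lemma coulomb_orthogonal:
  assumes "orthogonal_transformation T"
  shows "coulomb (\<chi> i. T (x $ i)) = coulomb x"
proof -
  have "norm (T u - T v) = norm (u - v)" for u v
    using assms by (metis linear_diff orthogonal_transformation_linear orthogonal_transformation_norm)
  then show ?thesis
    by (simp add: coulomb_def)
qed

lemma nn_integral_random_rotation:
  fixes v :: "real ^ 'd"
  assumes d: "2 \<le> CARD('d)" and [measurable]: "g \<in> borel_measurable borel"
  shows "(\<integral>\<^sup>+ A. g (A *v v) \<partial>random_rotation) = (\<integral>\<^sup>+ \<theta>. g (norm v *\<^sub>R \<theta>) \<partial>uniform_sphere)"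
proof -
  interpret \<nu>: prob_space "random_rotation :: (real ^ 'd ^ 'd) measure" by (rule prob_space_random_rotation)
  interpret \<sigma>: prob_space "uniform_sphere :: (real ^ 'd) measure" by (rule prob_space_uniform_sphere)
  show ?thesis
  proof (cases "v = 0")
    case True
    then show ?thesis
      by (simp add: \<nu>.emeasure_space_1 \<sigma>.emeasure_space_1)
  next
    case False
    have "(\<integral>\<^sup>+ \<theta>. g (norm v *\<^sub>R \<theta>) \<partial>uniform_sphere)
        = (\<integral>\<^sup>+ \<theta>. g (norm v *\<^sub>R \<theta>) \<partial>distr random_rotation borel (\<lambda>A. A *v sgn v))"
      using False by (simp add: distr_random_rotation_unit_vector[OF d] norm_sgn)
    also have "\<dots> = (\<integral>\<^sup>+ A. g (norm v *\<^sub>R (A *v sgn v)) \<partial>random_rotation)"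
      by (subst nn_integral_distr) auto
    also have "\<dots> = (\<integral>\<^sup>+ A. g (A *v v) \<partial>random_rotation)"
      using False by (simp add: sgn_div_norm flip: matrix_vector_mult_scaleR)
    finally show ?thesis
      by simp
  qed
qed

section \<open>Couplings obtained by rotating a family of configurations\<close>

definition rotated :: "(real ^ 'n) measure \<Rightarrow> (real ^ 'n \<Rightarrow> (real ^ 'd) ^ 'n) \<Rightarrow> ((real ^ 'd) ^ 'n) measure" where
  "rotated \<gamma> s = distr (\<gamma> \<Otimes>\<^sub>M random_rotation) borel (\<lambda>(r, A). \<chi> i. A *v s r $ i)"

lemma nn_integral_rotated:
  fixes g :: "(real ^ 'd) ^ 'n \<Rightarrow> ennreal"
  assumes [measurable_cong]: "sets \<gamma> = sets borel" and [measurable]: "s \<in> borel_measurable borel" "g \<in> borel_measurable borel"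
  shows "(\<integral>\<^sup>+ x. g x \<partial>rotated \<gamma> s) = (\<integral>\<^sup>+ r. (\<integral>\<^sup>+ A. g (\<chi> i. A *v s r $ i) \<partial>random_rotation) \<partial>\<gamma>)"
proof -
  interpret \<nu>: prob_space "random_rotation :: (real ^ 'd ^ 'd) measure" by (rule prob_space_random_rotation)
  have "(\<integral>\<^sup>+ x. g x \<partial>rotated \<gamma> s) = (\<integral>\<^sup>+ p. g (\<chi> i. snd p *v s (fst p) $ i) \<partial>(\<gamma> \<Otimes>\<^sub>M random_rotation))"
    unfolding rotated_def case_prod_beta by (subst nn_integral_distr) measurable
  also have "\<dots> = (\<integral>\<^sup>+ r. (\<integral>\<^sup>+ A. g (\<chi> i. A *v s r $ i) \<partial>random_rotation) \<partial>\<gamma>)"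
    by (subst \<nu>.nn_integral_fst[symmetric]) auto
  finally show ?thesis .
qed

text \<open>Almost every rotation drops out of an invariant integrand. Invariance is demanded for
  determinant 1 only, so that the lemma serves the orientation as well as the cost.\<close>

lemma nn_integral_rotated_invariant:
  fixes g :: "(real ^ 'd) ^ 'n \<Rightarrow> ennreal"
  assumes "sets \<gamma> = sets borel" "s \<in> borel_measurable borel" "g \<in> borel_measurable borel"
    and inv: "\<And>T x. orthogonal_transformation T \<Longrightarrow> det (matrix T) = 1 \<Longrightarrow> g (\<chi> i. T (x $ i)) = g x"
  shows "(\<integral>\<^sup>+ x. g x \<partial>rotated \<gamma> s) = (\<integral>\<^sup>+ r. g (s r) \<partial>\<gamma>)"
proof -
  interpret \<nu>: prob_space "random_rotation :: (real ^ 'd ^ 'd) measure" by (rule prob_space_random_rotation)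
  have "(\<integral>\<^sup>+ A. g (\<chi> i. A *v x $ i) \<partial>random_rotation) = g x" for x
  proof -
    have "(\<integral>\<^sup>+ A. g (\<chi> i. A *v x $ i) \<partial>random_rotation) = (\<integral>\<^sup>+ A. g x \<partial>(random_rotation :: (real ^ 'd ^ 'd) measure))"
    proof (rule nn_integral_cong_AE)
      show "AE A in random_rotation. g (\<chi> i. A *v x $ i) = g x"
        using AE_random_rotation
      proof eventually_elim
        case (elim A)
        then show ?case
          using inv[of "(*v) A" x] by (simp add: orthogonal_transformation_matrix)
      qed
    qed
    then show ?thesis
      by (simp add: \<nu>.emeasure_space_1)
  qed
  then show ?thesis
    by (simp add: nn_integral_rotated assms)
qed

lemma AE_couplings_nonneg:
  fixes \<gamma> :: "(real ^ 'n) measure"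
  assumes f: "f \<in> borel_measurable borel" and \<gamma>: "\<gamma> \<in> couplings (radial_part f)"
  shows "AE r in \<gamma>. \<forall>i. 0 \<le> r $ i"
proof -
  have [measurable_cong]: "sets \<gamma> = sets borel"
    using \<gamma> by (auto simp: couplings_def)
  have "AE r in \<gamma>. 0 \<le> r $ i" for i
  proof -
    have eq: "radial_part f = distr \<gamma> borel (\<lambda>r. r $ i)"
      using \<gamma> by (auto simp: couplings_def)
    have "AE t in distr \<gamma> borel (\<lambda>r. r $ i). 0 \<le> t"
      using AE_radial_part[OF f] unfolding eq .
    then show ?thesis
      by (subst (asm) AE_distr_iff) auto
  qed
  then show ?thesis
    by (simp add: AE_all_countable)
qed

text \<open>Given the radii, each single rotated point is uniform on its sphere whatever the
  configuration was; so the marginals depend on the radii alone, and these are distributed as in the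
  radial measure.\<close>

lemma rotated_minimal_coupling:
  fixes s :: "real ^ 'n \<Rightarrow> (real ^ 'd) ^ 'n"
  assumes d: "2 \<le> CARD('d)" and f: "f \<in> borel_measurable borel" and \<gamma>: "\<gamma> \<in> couplings (radial_part f)"
    and s [measurable]: "s \<in> borel_measurable borel" "\<And>r. (\<And>i. 0 \<le> r $ i) \<Longrightarrow> s r \<in> minimizers r"
  shows "rotated \<gamma> s \<in> couplings (radial_measure f)"
    and "total_cost (rotated \<gamma> s) = (\<integral>\<^sup>+ r. reduced_cost TYPE(real ^ 'd) r \<partial>\<gamma>)"
proof -
  have sets [measurable_cong]: "sets \<gamma> = sets borel" and prob: "prob_space \<gamma>"
    using \<gamma> by (auto simp: couplings_def)
  interpret \<gamma>: prob_space \<gamma> by (rule prob)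
  interpret \<nu>: prob_space "random_rotation :: (real ^ 'd ^ 'd) measure" by (rule prob_space_random_rotation)
  interpret \<sigma>: prob_space "uniform_sphere :: (real ^ 'd) measure" by (rule prob_space_uniform_sphere)
  interpret P: pair_prob_space \<gamma> "random_rotation :: (real ^ 'd ^ 'd) measure" ..
  show "rotated \<gamma> s \<in> couplings (radial_measure f)"
  proof (rule couplingsI)
    show "sets (rotated \<gamma> s) = sets borel"
      by (simp add: rotated_def)
    show "prob_space (rotated \<gamma> s)"
      unfolding rotated_def case_prod_beta by (rule P.prob_space_distr) measurable
    fix i and g :: "real ^ 'd \<Rightarrow> ennreal" assume [measurable]: "g \<in> borel_measurable borel"
    have "(\<integral>\<^sup>+ x. g (x $ i) \<partial>rotated \<gamma> s) = (\<integral>\<^sup>+ r. (\<integral>\<^sup>+ A. g (A *v s r $ i) \<partial>random_rotation) \<partial>\<gamma>)"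
      by (subst nn_integral_rotated) (auto simp: sets)
    also have "\<dots> = (\<integral>\<^sup>+ r. (\<integral>\<^sup>+ \<theta>. g (norm (s r $ i) *\<^sub>R \<theta>) \<partial>uniform_sphere) \<partial>\<gamma>)"
      by (simp add: nn_integral_random_rotation[OF d])
    also have "\<dots> = (\<integral>\<^sup>+ r. (\<integral>\<^sup>+ \<theta>. g (r $ i *\<^sub>R \<theta>) \<partial>uniform_sphere) \<partial>\<gamma>)"
    proof (rule nn_integral_cong_AE)
      show "AE r in \<gamma>. (\<integral>\<^sup>+ \<theta>. g (norm (s r $ i) *\<^sub>R \<theta>) \<partial>uniform_sphere) = (\<integral>\<^sup>+ \<theta>. g (r $ i *\<^sub>R \<theta>) \<partial>uniform_sphere)"
        using AE_couplings_nonneg[OF f \<gamma>]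
      proof eventually_elim
        case (elim r)
        then have "norm (s r $ i) = r $ i"
          using s(2)[of r] by (simp add: minimizers_def configurations_def)
        then show ?case
          by simp
      qed
    qed
    also have "\<dots> = (\<integral>\<^sup>+ t. (\<integral>\<^sup>+ \<theta>. g (t *\<^sub>R \<theta>) \<partial>uniform_sphere) \<partial>radial_part f)"
      by (rule couplings_nn_integral[OF \<gamma>]) measurable
    also have "\<dots> = (\<integral>\<^sup>+ x. g x \<partial>radial_measure f)"
      by (simp add: nn_integral_radial_measure)
    finally show "(\<integral>\<^sup>+ x. g (x $ i) \<partial>rotated \<gamma> s) = (\<integral>\<^sup>+ x. g x \<partial>radial_measure f)" .
  qed simp
  have "total_cost (rotated \<gamma> s) = (\<integral>\<^sup>+ r. coulomb (s r) \<partial>\<gamma>)"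
    unfolding total_cost_def by (rule nn_integral_rotated_invariant) (auto simp: sets coulomb_orthogonal)
  also have "\<dots> = (\<integral>\<^sup>+ r. reduced_cost TYPE(real ^ 'd) r \<partial>\<gamma>)"
  proof (rule nn_integral_cong_AE)
    show "AE r in \<gamma>. coulomb (s r) = reduced_cost TYPE(real ^ 'd) r"
      using AE_couplings_nonneg[OF f \<gamma>] by eventually_elim (use s(2) in \<open>simp add: minimizers_def\<close>)
  qed
  finally show "total_cost (rotated \<gamma> s) = (\<integral>\<^sup>+ r. reduced_cost TYPE(real ^ 'd) r \<partial>\<gamma>)" .
qed

section \<open>Averaging over permutations of the points\<close>

definition symmetrization :: "(('a::euclidean_space) ^ 'n) measure \<Rightarrow> ('a ^ 'n) measure" where
  "symmetrization \<Gamma> =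
     distr (measure_pmf (pmf_of_set {\<pi>. \<pi> permutes UNIV}) \<Otimes>\<^sub>M \<Gamma>) borel (\<lambda>(\<pi>, x). \<chi> i. x $ \<pi> i)"

lemma permutations_UNIV: "finite {\<pi> :: 'n::finite \<Rightarrow> 'n. \<pi> permutes UNIV}" "{\<pi> :: 'n \<Rightarrow> 'n. \<pi> permutes UNIV} \<noteq> {}"
  using permutes_id[of "UNIV :: 'n set"] by (simp add: finite_permutations, blast)

lemma permutation_measurable:
  fixes \<Gamma> :: "(('a::euclidean_space) ^ 'n) measure"
  assumes [measurable_cong]: "sets \<Gamma> = sets borel"
  shows "(\<lambda>(\<pi>, x). \<chi> i. x $ \<pi> i :: 'a ^ 'n) \<in> measure_pmf p \<Otimes>\<^sub>M \<Gamma> \<rightarrow>\<^sub>M borel"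
proof -
  have "(\<lambda>(\<pi>, x). \<chi> i. x $ \<pi> i :: 'a ^ 'n) \<in> count_space UNIV \<Otimes>\<^sub>M \<Gamma> \<rightarrow>\<^sub>M borel"
    by (rule measurable_pair_measure_countable1) auto
  then show ?thesis
    by (subst measurable_cong_sets[OF sets_pair_measure_cong[OF sets_measure_pmf_count_space refl] refl])
qed

text \<open>Applying an independent uniform permutation gives a probability measure by construction;
  this formula recovers the plain average over all permutations.\<close>

lemma nn_integral_symmetrization:
  fixes \<Gamma> :: "(('a::euclidean_space) ^ 'n) measure"
  assumes sets [measurable_cong]: "sets \<Gamma> = sets borel" and prob: "prob_space \<Gamma>" and g [measurable]: "g \<in> borel_measurable borel"
  shows "(\<integral>\<^sup>+ x. g x \<partial>symmetrization \<Gamma>) =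
    (\<Sum>\<pi> | \<pi> permutes UNIV. \<integral>\<^sup>+ x. g (\<chi> i. x $ \<pi> i) \<partial>\<Gamma>) / of_nat (card {\<pi> :: 'n \<Rightarrow> 'n. \<pi> permutes UNIV})"
proof -
  interpret \<Gamma>: prob_space \<Gamma> by (rule prob)
  let ?p = "measure_pmf (pmf_of_set {\<pi> :: 'n \<Rightarrow> 'n. \<pi> permutes UNIV})"
  have "(\<integral>\<^sup>+ x. g x \<partial>symmetrization \<Gamma>) = (\<integral>\<^sup>+ p. g (case p of (\<pi>, x) \<Rightarrow> \<chi> i. x $ \<pi> i) \<partial>(?p \<Otimes>\<^sub>M \<Gamma>))"
    unfolding symmetrization_def by (rule nn_integral_distr[OF permutation_measurable[OF sets]]) simp
  also have "\<dots> = (\<integral>\<^sup>+ \<pi>. (\<integral>\<^sup>+ x. g (\<chi> i. x $ \<pi> i) \<partial>\<Gamma>) \<partial>?p)"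
    by (subst \<Gamma>.nn_integral_fst[symmetric])
      (use measurable_compose[OF permutation_measurable[OF sets] g] in \<open>simp_all\<close>)
  also have "\<dots> = (\<Sum>\<pi> | \<pi> permutes UNIV. \<integral>\<^sup>+ x. g (\<chi> i. x $ \<pi> i) \<partial>\<Gamma>) / of_nat (card {\<pi> :: 'n \<Rightarrow> 'n. \<pi> permutes UNIV})"
    by (rule nn_integral_pmf_of_set[OF permutations_UNIV(2) permutations_UNIV(1)])
  finally show ?thesis .
qed

lemma nn_integral_symmetrization_eq:
  fixes \<Gamma> :: "(('a::euclidean_space) ^ 'n) measure"
  assumes "sets \<Gamma> = sets borel" "prob_space \<Gamma>" "g \<in> borel_measurable borel"
    and "\<And>\<pi>. \<pi> permutes UNIV \<Longrightarrow> (\<integral>\<^sup>+ x. g (\<chi> i. x $ \<pi> i) \<partial>\<Gamma>) = c"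
  shows "(\<integral>\<^sup>+ x. g x \<partial>symmetrization \<Gamma>) = c"
proof -
  have "card {\<pi> :: 'n \<Rightarrow> 'n. \<pi> permutes UNIV} \<noteq> 0"
    using permutations_UNIV by (simp add: card_eq_0_iff)
  then show ?thesis
    using assms
    by (simp add: nn_integral_symmetrization mult.commute[of "of_nat _"] ennreal_mult_divide_eq)
qed

lemma symmetrization_coupling:
  fixes \<Gamma> :: "(('a::euclidean_space) ^ 'n) measure"
  assumes \<Gamma>: "\<Gamma> \<in> couplings \<mu>" and \<mu>: "sets \<mu> = sets borel"
  shows "symmetrization \<Gamma> \<in> couplings \<mu>" "symmetric_measure (symmetrization \<Gamma>)"
    "total_cost (symmetrization \<Gamma>) = total_cost \<Gamma>"
proof -
  have sets [measurable_cong]: "sets \<Gamma> = sets borel" and prob: "prob_space \<Gamma>"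
    using \<Gamma> by (auto simp: couplings_def)
  let ?p = "measure_pmf (pmf_of_set {\<pi> :: 'n \<Rightarrow> 'n. \<pi> permutes UNIV})"
  interpret \<Gamma>: prob_space \<Gamma> by (rule prob)
  interpret P: pair_prob_space ?p \<Gamma> ..
  have sets_sym: "sets (symmetrization \<Gamma>) = sets borel"
    by (simp add: symmetrization_def)
  show "symmetrization \<Gamma> \<in> couplings \<mu>"
  proof (rule couplingsI[OF sets_sym _ \<mu>])
    show "prob_space (symmetrization \<Gamma>)"
      unfolding symmetrization_def by (rule P.prob_space_distr[OF permutation_measurable[OF sets]])
    fix i and g :: "'a \<Rightarrow> ennreal" assume g [measurable]: "g \<in> borel_measurable borel"
    show "(\<integral>\<^sup>+ x. g (x $ i) \<partial>symmetrization \<Gamma>) = (\<integral>\<^sup>+ t. g t \<partial>\<mu>)"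
      by (rule nn_integral_symmetrization_eq[OF sets prob]) (simp_all add: couplings_nn_integral[OF \<Gamma> g])
  qed
  show "symmetric_measure (symmetrization \<Gamma>)"
    unfolding symmetric_measure_def
  proof (intro allI impI)
    fix \<pi> :: "'n \<Rightarrow> 'n" assume \<pi>: "\<pi> permutes UNIV"
    show "distr (symmetrization \<Gamma>) borel (\<lambda>x. \<chi> i. x $ \<pi> i) = symmetrization \<Gamma>"
    proof (rule distr_eqI_nn_integral[OF _ sets_sym])
      show "(\<lambda>x. \<chi> i. x $ \<pi> i) \<in> symmetrization \<Gamma> \<rightarrow>\<^sub>M borel"
        by (simp add: measurable_cong_sets[OF sets_sym refl])
      fix g :: "'a ^ 'n \<Rightarrow> ennreal" assume [measurable]: "g \<in> borel_measurable borel"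
      have "(\<integral>\<^sup>+ x. g (\<chi> i. x $ \<pi> i) \<partial>symmetrization \<Gamma>) =
          (\<Sum>\<tau> | \<tau> permutes UNIV. \<integral>\<^sup>+ x. g (\<chi> i. x $ (\<tau> \<circ> \<pi>) i) \<partial>\<Gamma>) / of_nat (card {\<pi> :: 'n \<Rightarrow> 'n. \<pi> permutes UNIV})"
        by (subst nn_integral_symmetrization[OF sets prob]) simp_all
      also have "(\<Sum>\<tau> | \<tau> permutes UNIV. \<integral>\<^sup>+ x. g (\<chi> i. x $ (\<tau> \<circ> \<pi>) i) \<partial>\<Gamma>)
          = (\<Sum>\<tau> | \<tau> permutes UNIV. \<integral>\<^sup>+ x. g (\<chi> i. x $ \<tau> i) \<partial>\<Gamma>)"
        by (rule sum_permutations_compose_right[OF \<pi>, symmetric])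
      finally show "(\<integral>\<^sup>+ x. g (\<chi> i. x $ \<pi> i) \<partial>symmetrization \<Gamma>) = (\<integral>\<^sup>+ x. g x \<partial>symmetrization \<Gamma>)"
        by (simp add: nn_integral_symmetrization[OF sets prob])
    qed
  qed
  have "coulomb (\<chi> i. x $ \<pi> i) = coulomb x" if \<pi>: "\<pi> permutes UNIV" for \<pi> and x :: "'a ^ 'n"
  proof -
    have bij: "bij \<pi>"
      using \<pi> by (rule permutes_bij)
    then have bij_j: "bij_betw \<pi> (UNIV - {i}) (UNIV - {\<pi> i})" for i
      by (metis bij_betw_DiffI bij_betw_singletonI subset_UNIV)
    have "coulomb (\<chi> i. x $ \<pi> i) = (\<Sum>i\<in>UNIV. \<Sum>j\<in>UNIV - {\<pi> i}. 1 / ennreal (norm (x $ \<pi> i - x $ j)))"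
      unfolding coulomb_def vec_lambda_beta
      by (intro sum.cong refl sum.reindex_bij_betw[OF bij_j, of "\<lambda>j. 1 / ennreal (norm (x $ \<pi> i - x $ j))" for i])
    also have "\<dots> = coulomb x"
      unfolding coulomb_def by (rule sum.reindex_bij_betw[OF bij])
    finally show ?thesis .
  qed
  then show "total_cost (symmetrization \<Gamma>) = total_cost \<Gamma>"
    unfolding total_cost_def by (intro nn_integral_symmetrization_eq[OF sets prob]) simp_all
qed

subsection \<open>Orientation\<close>

text \<open>Replaces spanning by finitely many measurable conditions, one for each \<open>J\<close>,
  so that a single \<open>J\<close> can be fixed for a set of radii of positive measure.\<close>

lemma spanning_tuple:
  fixes x :: "(real ^ 'd) ^ 'n"
  assumes "span (range (\<lambda>i. x $ i)) = UNIV"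
  obtains J :: "'d \<Rightarrow> 'n" where "det (\<chi> k. x $ J k) \<noteq> 0"
proof -
  obtain B where B: "B \<subseteq> range (\<lambda>i. x $ i)" "independent B" "range (\<lambda>i. x $ i) \<subseteq> span B"
    using maximal_independent_subset by blast
  have span_B: "span B = UNIV"
    using span_mono[OF B(3)] assms by (auto simp: span_span)
  have "card B = CARD('d)"
    using dim_eq_card[of B UNIV] B(2) span_B by simp
  then obtain g where g: "bij_betw g (UNIV :: 'd set) B"
    using finite_same_card_bij[of "UNIV :: 'd set" B] finiteI_independent[OF B(2)] by auto
  have "\<forall>k. \<exists>i. g k = x $ i"
    using g B(1) by (auto simp: bij_betw_def)
  from choice[OF this] obtain J where J: "\<And>k. g k = x $ J k"
    by blast
  have "rows (\<chi> k. x $ J k) = B"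
    using g by (auto simp: rows_def row_def bij_betw_def J)
  then have "det (\<chi> k. x $ J k) \<noteq> 0"
    using span_B matrix_left_invertible_span_rows[of "\<chi> k. x $ J k"]
    by (simp add: invertible_det_nz[symmetric] invertible_left_inverse)
  then show thesis
    by (rule that)
qed

text \<open>
  The tuples whose radii lie in prescribed disjoint windows contribute their determinant: this makes
  the orientation independent of the order of the points.
\<close>

definition orientation :: "('d \<Rightarrow> real set) \<Rightarrow> (real ^ 'd) ^ 'n \<Rightarrow> real" where
  "orientation W x = (\<Sum>J\<in>UNIV. if \<forall>k. norm (x $ J k) \<in> W k then det (\<chi> k. x $ J k) else 0)"

lemma orientation_permute:
  assumes "\<pi> permutes UNIV"
  shows "orientation W (\<chi> i. x $ \<pi> i) = orientation W (x :: (real ^ 'd) ^ 'n)"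
proof -
  have "bij (\<lambda>J :: 'd \<Rightarrow> 'n. \<pi> \<circ> J)"
    by (rule o_bij[of "\<lambda>J. inv \<pi> \<circ> J"]) (use permutes_inv_o[OF assms] in \<open>auto simp: fun_eq_iff\<close>)
  from sum.reindex_bij_betw[OF this, of "\<lambda>J. if \<forall>k. norm (x $ J k) \<in> W k then det (\<chi> k. x $ J k) else 0"]
  show ?thesis
    by (simp add: orientation_def cong: if_cong)
qed

lemma orientation_orthogonal:
  assumes "orthogonal_transformation T"
  shows "orientation W (\<chi> i. T (x $ i)) = det (matrix T) * orientation W x"
  unfolding orientation_def sum_distrib_left
  by (intro sum.cong refl)
    (simp add: orthogonal_transformation_norm[OF assms] det_transformed_rows[OF orthogonal_transformation_linear[OF assms]])

lemma borel_measurable_orientation [measurable]: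
  assumes [measurable]: "\<And>k. W k \<in> sets borel"
  shows "orientation W \<in> borel_measurable borel"
  unfolding orientation_def[abs_def] by measurable

text \<open>If each window catches exactly one point, a single tuple contributes, so no other
  determinant can cancel it.\<close>

lemma orientation_single_tuple:
  assumes "\<And>i k. norm (x $ i) \<in> W k \<longleftrightarrow> i = J k"
  shows "orientation W x = det (\<chi> k. x $ J k)"
proof -
  have "(\<forall>k. norm (x $ J' k) \<in> W k) \<longleftrightarrow> J' = J" for J'
    using assms by (auto simp: fun_eq_iff)
  then show ?thesis
    unfolding orientation_def by (simp add: sum.delta)
qed

text \<open>One orthogonal map applied to all points respects the radial marginals, the mutual
  distances and the permutations. With a reflection, this makes the mirror image of an optimal
  symmetric coupling optimal and symmetric again.\<close>

lemma distr_orthogonal_coupling: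
  fixes T :: "'a::euclidean_space \<Rightarrow> 'a" and \<Gamma> :: "(('a::euclidean_space) ^ 'n) measure"
  assumes T: "orthogonal_transformation T" and \<Gamma>: "\<Gamma> \<in> couplings (radial_measure f)"
  defines "\<Gamma>' \<equiv> distr \<Gamma> borel (\<lambda>x. \<chi> i. T (x $ i))"
  shows "\<Gamma>' \<in> couplings (radial_measure f)" "symmetric_measure \<Gamma> \<Longrightarrow> symmetric_measure \<Gamma>'"
    "total_cost \<Gamma>' = total_cost \<Gamma>"
proof -
  have sets [measurable_cong]: "sets \<Gamma> = sets borel" and prob: "prob_space \<Gamma>"
    using \<Gamma> by (auto simp: couplings_def)
  note [measurable] = borel_measurable_orthogonal_transformation[OF T]
  have nn: "(\<integral>\<^sup>+ x. g x \<partial>\<Gamma>') = (\<integral>\<^sup>+ x. g (\<chi> i. T (x $ i)) \<partial>\<Gamma>)" if [measurable]: "g \<in> borel_measurable borel" for g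
    unfolding \<Gamma>'_def by (subst nn_integral_distr) auto
  show "\<Gamma>' \<in> couplings (radial_measure f)"
  proof (rule couplingsI)
    show "prob_space \<Gamma>'"
      unfolding \<Gamma>'_def by (rule prob_space.prob_space_distr[OF prob]) measurable
    fix i and g :: "'a \<Rightarrow> ennreal" assume [measurable]: "g \<in> borel_measurable borel"
    have "(\<integral>\<^sup>+ x. g (x $ i) \<partial>\<Gamma>') = (\<integral>\<^sup>+ x. g (T (x $ i)) \<partial>\<Gamma>)"
      by (subst nn) simp_all
    also have "\<dots> = (\<integral>\<^sup>+ x. g (T x) \<partial>radial_measure f)"
      by (rule couplings_nn_integral[OF \<Gamma>]) measurable
    also have "\<dots> = (\<integral>\<^sup>+ x. g x \<partial>distr (radial_measure f) borel T)"
      by (subst nn_integral_distr) (auto simp: measurable_cong_sets[OF sets_radial_measure refl])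
    finally show "(\<integral>\<^sup>+ x. g (x $ i) \<partial>\<Gamma>') = (\<integral>\<^sup>+ x. g x \<partial>radial_measure f)"
      by (simp add: distr_orthogonal_radial_measure[OF T])
  qed (simp_all add: \<Gamma>'_def)
  show "total_cost \<Gamma>' = total_cost \<Gamma>"
    unfolding total_cost_def by (subst nn) (simp_all add: coulomb_orthogonal[OF T])
  assume sym: "symmetric_measure \<Gamma>"
  show "symmetric_measure \<Gamma>'"
    unfolding symmetric_measure_def
  proof (intro allI impI)
    fix \<pi> :: "'n \<Rightarrow> 'n" assume "\<pi> permutes UNIV"
    then have eq: "distr \<Gamma> borel (\<lambda>x. \<chi> i. x $ \<pi> i) = \<Gamma>"
      using sym by (auto simp: symmetric_measure_def)
    have "distr \<Gamma>' borel (\<lambda>x. \<chi> i. x $ \<pi> i) = distr \<Gamma> borel (\<lambda>x. \<chi> i. T (x $ \<pi> i))"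
      unfolding \<Gamma>'_def by (subst distr_distr) (auto simp: comp_def)
    also have "\<dots> = distr (distr \<Gamma> borel (\<lambda>x. \<chi> i. x $ \<pi> i)) borel (\<lambda>x. \<chi> i. T (x $ i))"
      by (subst distr_distr) (auto simp: comp_def)
    finally show "distr \<Gamma>' borel (\<lambda>x. \<chi> i. x $ \<pi> i) = \<Gamma>'"
      by (simp add: eq \<Gamma>'_def)
  qed
qed

lemma minimizers_orthogonal:
  fixes T :: "'a::euclidean_space \<Rightarrow> 'a"
  assumes "orthogonal_transformation T" "x \<in> minimizers r"
  shows "(\<chi> i. T (x $ i)) \<in> minimizers r"
  using assms
  by (simp add: minimizers_def configurations_def coulomb_orthogonal orthogonal_transformation_norm)

theorem proposition3p2p4:
  fixes f :: "real \<Rightarrow> real" and \<rho> :: "(real ^ 'd) measure"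
  assumes "CARD('n::finite) \<ge> 3" and "CARD('d::finite) \<ge> 2"
    and "f \<in> borel_measurable borel" and "\<And>r. 0 \<le> r \<Longrightarrow> 0 \<le> f r"
    and "\<rho> = radial_measure f" and "prob_space \<rho>"
    and "\<exists>\<gamma> :: (real ^ 'n) measure.
           reduced_minimizer TYPE(real ^ 'd) (radial_part f) \<gamma> \<and>
           (\<exists>r \<in> spt \<gamma>.
              inj (\<lambda>i. r $ i) \<and>
              (\<exists>x :: (real ^ 'd) ^ 'n.
                 x \<in> configurations r \<and>
                 coulomb x = reduced_cost TYPE(real ^ 'd) r \<and>
                 span (range (\<lambda>i. x $ i)) = UNIV))"
  shows "\<exists>\<rho>\<^sub>1 \<rho>\<^sub>2 :: ((real ^ 'd) ^ 'n) measure.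
           \<rho>\<^sub>1 \<noteq> \<rho>\<^sub>2 \<and>
           (\<forall>\<rho>' \<in> {\<rho>\<^sub>1, \<rho>\<^sub>2}.
              \<rho>' \<in> couplings \<rho> \<and> symmetric_measure \<rho>' \<and>
              total_cost \<rho>' = min_cost TYPE('n) \<rho>)"
proof -
  note d = assms(2) and f [measurable] = assms(3)
  obtain \<gamma> :: "(real ^ 'n) measure" and r and x :: "(real ^ 'd) ^ 'n" where
    min: "reduced_minimizer TYPE(real ^ 'd) (radial_part f) \<gamma>" and r: "r \<in> spt \<gamma>"
    and inj: "inj (\<lambda>i. r $ i)" and x: "x \<in> minimizers r" "span (range (\<lambda>i. x $ i)) = UNIV"
    using assms(7) by (auto simp: minimizers_def)
  have \<gamma>: "\<gamma> \<in> couplings (radial_part f)"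
    using min by (simp add: reduced_minimizer_def)
  then have sets [measurable_cong]: "sets \<gamma> = sets borel"
    by (simp add: couplings_def)
  obtain \<epsilon> where \<epsilon>: "\<epsilon> > 0"
    "\<And>s (y :: (real ^ 'd) ^ 'n). dist s r < \<epsilon> \<Longrightarrow> y \<in> minimizers s \<Longrightarrow> span (range (\<lambda>i. y $ i)) = UNIV"
    using minimizers_span_nearby[OF inj x] by metis
  obtain \<delta> where \<delta>: "\<delta> > 0" "\<And>i j. i \<noteq> j \<Longrightarrow> 2 * \<delta> \<le> \<bar>r $ i - r $ j\<bar>"
  proof -
    \<comment> \<open>The entry 1 makes the set nonempty by construction, so that \<open>Min\<close>
      applies; \<open>\<delta>\<close> becomes half the minimum.\<close>
    define gaps where "gaps = insert 1 ((\<lambda>(i, j). \<bar>r $ i - r $ j\<bar>) ` {(i, j). i \<noteq> j})"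
    have gaps: "finite gaps" "gaps \<noteq> {}"
      by (auto simp: gaps_def)
    have "\<forall>g\<in>gaps. 0 < g"
      using inj by (auto simp: gaps_def dest: injD)
    then have "0 < Min gaps"
      using gaps by simp
    moreover have "Min gaps \<le> \<bar>r $ i - r $ j\<bar>" if "i \<noteq> j" for i j
      using gaps that by (intro Min_le) (auto simp: gaps_def)
    ultimately show thesis
      by (intro that[of "Min gaps / 2"]) auto
  qed
  \<comment> \<open>\<open>\<epsilon>\<close> makes every minimizer over \<open>V\<close> span;
    \<open>\<delta>\<close> keeps each radius closer to its own \<open>r $ i\<close> than to any
    other.\<close>
  define V where "V = ball r (min \<epsilon> \<delta>)"
  have "0 < emeasure \<gamma> V"
    using r \<epsilon>(1) \<delta>(1) by (auto simp: spt_def V_def)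
  obtain s :: "real ^ 'n \<Rightarrow> (real ^ 'd) ^ 'n" where s [measurable]: "s \<in> borel_measurable borel"
    and s_min: "\<And>r. (\<And>i. 0 \<le> r $ i) \<Longrightarrow> s r \<in> minimizers r"
    using measurable_minimizer by blast
  \<comment> \<open>There are finitely many \<open>J\<close>. If each determinant vanished almost
    everywhere on \<open>V\<close>, all would vanish together there, although \<open>s q\<close>
    spans and \<open>V\<close> has positive measure.\<close>
  have "\<exists>J :: 'd \<Rightarrow> 'n. \<not> (AE q in \<gamma>. q \<in> V \<longrightarrow> det (\<chi> k. s q $ J k) = 0)"
  proof (rule ccontr)
    assume "\<not> ?thesis"
    then have "AE q in \<gamma>. \<forall>J :: 'd \<Rightarrow> 'n. q \<in> V \<longrightarrow> det (\<chi> k. s q $ J k) = 0"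
      by (subst AE_all_countable) blast
    moreover note AE_couplings_nonneg[OF f \<gamma>]
    ultimately have "AE q in \<gamma>. q \<notin> V"
    proof eventually_elim
      case (elim q)
      show ?case
      proof
        assume "q \<in> V"
        then have "span (range (\<lambda>i. s q $ i)) = UNIV"
          using elim(2) by (intro \<epsilon>(2)[of q] s_min) (auto simp: V_def dist_commute)
        then obtain J :: "'d \<Rightarrow> 'n" where "det (\<chi> k. s q $ J k) \<noteq> 0"
          by (rule spanning_tuple)
        then show False
          using elim(1) \<open>q \<in> V\<close> by blast
      qed
    qed
    then have "emeasure \<gamma> V = 0"
      by (subst (asm) AE_iff_measurable[of V]) (auto simp: V_def sets sets_eq_imp_space_eq[OF sets])
    then show False
      using \<open>0 < emeasure \<gamma> V\<close> by simp
  qed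
  then obtain J :: "'d \<Rightarrow> 'n" where J: "\<not> (AE q in \<gamma>. q \<in> V \<longrightarrow> det (\<chi> k. s q $ J k) = 0)"
    by blast
  \<comment> \<open>Windows around the radii of the tuple \<open>J\<close>. For \<open>q\<close> in
    \<open>V\<close> every \<open>q $ i\<close> is within \<open>\<delta>\<close> of
    \<open>r $ i\<close>, while different entries of \<open>r\<close> are at least
    \<open>2 * \<delta>\<close> apart, so a window recognizes its point.\<close>
  define W where "W k = ball (r $ J k) \<delta>" for k
  define ori :: "(real ^ 'd) ^ 'n \<Rightarrow> real" where "ori = orientation W"
  have ori_meas [measurable]: "(ori :: (real ^ 'd) ^ 'n \<Rightarrow> real) \<in> borel_measurable borel"
    unfolding ori_def by (intro borel_measurable_orientation) (simp add: W_def)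
  have ori_local: "ori (s q) = det (\<chi> k. s q $ J k)" if "q \<in> V" "\<And>i. 0 \<le> q $ i" for q
    unfolding ori_def
  proof (rule orientation_single_tuple)
    fix i k
    have norm: "norm (s q $ i) = q $ i" for i
      using s_min[OF that(2)] by (simp add: minimizers_def configurations_def)
    have close: "\<bar>q $ i - r $ i\<bar> < \<delta>" for i
      using that(1) component_le_norm_cart[of "q - r" i] by (simp add: V_def dist_norm norm_minus_commute)
    show "norm (s q $ i) \<in> W k \<longleftrightarrow> i = J k"
    proof
      assume "norm (s q $ i) \<in> W k"
      then have "\<bar>r $ J k - q $ i\<bar> < \<delta>"
        by (simp add: W_def norm dist_real_def)
      then show "i = J k"
        using close[of i] \<delta>(2)[of i "J k"] by linarith
    qed (use close in \<open>auto simp: W_def norm dist_real_def abs_minus_commute\<close>)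
  qed
  define R where "R x = (\<chi> i. reflection (x $ i))" for x :: "(real ^ 'd) ^ 'n"
  have [measurable]: "R \<in> borel_measurable borel"
    unfolding R_def by measurable
  have ori_R: "ori (R x) = - ori x" for x
    using orientation_orthogonal[OF orthogonal_transformation_reflection, of W x]
    by (simp add: ori_def R_def det_reflection)
  have ori_permute: "ori (\<chi> i. x $ \<pi> i) = ori x" if "\<pi> permutes UNIV" for \<pi> x
    using orientation_permute[OF that] by (simp add: ori_def)
  have ori_rotate: "ori (\<chi> i. T (x $ i)) = ori x" if "orthogonal_transformation T" "det (matrix T) = 1" for T x
    using orientation_orthogonal[OF that(1), of W x] that(2) by (simp add: ori_def)
  \<comment> \<open>Normalizes the sign: every selected configuration now has nonnegative
    orientation, so contributions of opposite sign cannot hide the reflection.\<close>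
  define s' where "s' q = (if 0 \<le> ori (s q) then s q else R (s q))" for q
  have s' [measurable]: "s' \<in> borel_measurable borel"
    unfolding s'_def[abs_def] by measurable
  have s'_min: "s' q \<in> minimizers q" if "\<And>i. 0 \<le> q $ i" for q
    using s_min[OF that] minimizers_orthogonal[OF orthogonal_transformation_reflection s_min[OF that]]
    by (simp add: s'_def R_def)
  have ori_s': "ori (s' q) = \<bar>ori (s q)\<bar>" for q
    by (simp add: s'_def ori_R)
  define \<Gamma> where "\<Gamma> = rotated \<gamma> s'"
  define \<rho>\<^sub>1 where "\<rho>\<^sub>1 = symmetrization \<Gamma>"
  \<comment> \<open>Reflecting after the symmetrization lets the second measure inherit symmetry and
    optimality from the first.\<close>
  define \<rho>\<^sub>2 where "\<rho>\<^sub>2 = distr \<rho>\<^sub>1 borel R"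
  have \<Gamma>: "\<Gamma> \<in> couplings (radial_measure f)"
    "total_cost \<Gamma> = (\<integral>\<^sup>+ q. reduced_cost TYPE(real ^ 'd) q \<partial>\<gamma>)"
    unfolding \<Gamma>_def by (rule rotated_minimal_coupling[OF d f \<gamma> s' s'_min]; assumption)+
  then have \<Gamma>_sets: "sets \<Gamma> = sets borel" and \<Gamma>_prob: "prob_space \<Gamma>"
    by (simp_all add: couplings_def)
  have min_cost: "min_cost TYPE('n) \<rho> = total_cost \<Gamma>"
    unfolding min_cost_def assms(5)
  proof (rule antisym)
    show "(INF \<gamma> \<in> (couplings (radial_measure f) :: ((real ^ 'd) ^ 'n) measure set). total_cost \<gamma>) \<le> total_cost \<Gamma>"
      using \<Gamma>(1) by (rule INF_lower)
    show "total_cost \<Gamma> \<le> (INF \<gamma> \<in> (couplings (radial_measure f) :: ((real ^ 'd) ^ 'n) measure set). total_cost \<gamma>)"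
      unfolding \<Gamma>(2) by (intro INF_greatest reduced_minimizer_le_total_cost[OF f min])
  qed
  have \<rho>\<^sub>1: "\<rho>\<^sub>1 \<in> couplings (radial_measure f)" "symmetric_measure \<rho>\<^sub>1" "total_cost \<rho>\<^sub>1 = total_cost \<Gamma>"
    unfolding \<rho>\<^sub>1_def using symmetrization_coupling[OF \<Gamma>(1)] by simp_all
  have \<rho>\<^sub>2: "\<rho>\<^sub>2 \<in> couplings (radial_measure f)" "symmetric_measure \<rho>\<^sub>2" "total_cost \<rho>\<^sub>2 = total_cost \<Gamma>"
    using distr_orthogonal_coupling[OF orthogonal_transformation_reflection \<rho>\<^sub>1(1)] \<rho>\<^sub>1(2,3)
    by (simp_all add: \<rho>\<^sub>2_def R_def[abs_def])
  \<comment> \<open>Neither rotating nor permuting the points changes \<open>ori\<close>; its law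
    under \<open>\<rho>\<^sub>1\<close> is therefore that of the absolute orientation of
    \<open>s q\<close> under \<open>\<gamma>\<close>.\<close>
  have \<rho>\<^sub>1_ori: "(\<integral>\<^sup>+ x. g (ori x) \<partial>\<rho>\<^sub>1) = (\<integral>\<^sup>+ q. g \<bar>ori (s q)\<bar> \<partial>\<gamma>)" if [measurable]: "g \<in> borel_measurable borel" for g
  proof -
    have "(\<integral>\<^sup>+ x. g (ori x) \<partial>\<rho>\<^sub>1) = (\<integral>\<^sup>+ x. g (ori x) \<partial>\<Gamma>)"
      unfolding \<rho>\<^sub>1_def
      by (rule nn_integral_symmetrization_eq[OF \<Gamma>_sets \<Gamma>_prob]) (simp_all add: ori_permute)
    also have "\<dots> = (\<integral>\<^sup>+ q. g (ori (s' q)) \<partial>\<gamma>)"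
      unfolding \<Gamma>_def
      by (rule nn_integral_rotated_invariant) (simp_all add: sets ori_rotate)
    finally show ?thesis
      by (simp add: ori_s')
  qed
  have "\<rho>\<^sub>1 \<noteq> \<rho>\<^sub>2"
  proof
    assume eq: "\<rho>\<^sub>1 = \<rho>\<^sub>2"
    have \<rho>\<^sub>1_sets [measurable_cong]: "sets \<rho>\<^sub>1 = sets borel"
      using \<rho>\<^sub>1(1) by (simp add: couplings_def)
    \<comment> \<open>Positive orientation under \<open>\<rho>\<^sub>2\<close> is negative
      orientation under \<open>\<rho>\<^sub>1\<close>, which has probability 0. Equality of the
      measures would thus force \<open>ori (s q) = 0\<close> almost everywhere, against the choice
      of \<open>J\<close>.\<close>
    have "(\<integral>\<^sup>+ q. indicator {0<..} \<bar>ori (s q)\<bar> \<partial>\<gamma>) = (\<integral>\<^sup>+ x. indicator {0<..} (ori x) \<partial>\<rho>\<^sub>1)"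
      by (subst \<rho>\<^sub>1_ori) simp_all
    also have "\<dots> = (\<integral>\<^sup>+ x. indicator {0<..} (ori x) \<partial>distr \<rho>\<^sub>1 borel R)"
      using eq by (simp add: \<rho>\<^sub>2_def)
    also have "\<dots> = (\<integral>\<^sup>+ x. indicator {0<..} (- ori x) \<partial>\<rho>\<^sub>1)"
      by (subst nn_integral_distr) (auto simp: ori_R)
    also have "\<dots> = (\<integral>\<^sup>+ q. indicator {0<..} (- \<bar>ori (s q)\<bar>) \<partial>\<gamma>)"
      by (subst \<rho>\<^sub>1_ori[of "\<lambda>t. indicator {0<..} (- t)"]) simp_all
    also have "\<dots> = 0"
      by (simp add: indicator_def)
    finally have "AE q in \<gamma>. indicator {0<..} \<bar>ori (s q)\<bar> = (0 :: ennreal)"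
      by (subst (asm) nn_integral_0_iff_AE) auto
    with AE_couplings_nonneg[OF f \<gamma>] have "AE q in \<gamma>. q \<in> V \<longrightarrow> det (\<chi> k. s q $ J k) = 0"
    proof eventually_elim
      case (elim q)
      then show ?case
        using ori_local[of q] by (auto simp: indicator_def split: if_splits)
    qed
    then show False
      using J by contradiction
  qed
  then show ?thesis
    using \<rho>\<^sub>1 \<rho>\<^sub>2 min_cost assms(5) by (intro exI[of _ \<rho>\<^sub>1] exI[of _ \<rho>\<^sub>2]) auto
qed

end
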